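(* Fix an integer $n\ge0$ and $T>0$. Let $\Phi$ be the solution of the $\ell_0$-periodic Kuramoto–Sivashinsky problem $$\Phi_\tau+4\Phi_{\eta\eta\eta\eta}+\Phi_{\eta\eta}+\tfrac12(\Phi_\eta)^2=0,\qquad\Phi(0)=\Phi_0,$$ with $\Phi_0$ regular enough that $\Psi:=\Phi_\eta\in C([0,T];H^{n+4}_\sharp)\cap C^1([0,T];L^2)$ and $\Psi_\tau\in C([0,T];H^{n+2}_\sharp)$. Then there exist $\varepsilon_1=\varepsilon_1(n,T)\in(0,1)$ and $K_n>0$ with the following property. Let $0<\varepsilon\le\varepsilon_1$ and $T_1\le T$, and let $\zeta\in\mathscr Y_n(T_1)$ have zero mean in $\eta$ and $\zeta(0,\cdot)=0$. If $\zeta$ solves on $[0,T_1]$ $$\partial_\tau\big(B_\varepsilon\zeta\big)+H_\varepsilon(\Psi_\tau)=S\zeta+M_\varepsilon\big((\Psi^2)_\eta\big)+\varepsilon F_\varepsilon\big((\zeta^2)_\eta\big)+2F_\varepsilon\big((\Psi\zeta)_\eta\big),\qquad(\ast)$$ then $$\sup_{\tau\in[0,T_1]}\int_{-\ell_0/2}^{\ell_0/2}|D^n\zeta(\tau,\cdot)|^2d\eta+\varepsilon\sup_{\tau\in[0,T_1]}\int_{-\ell_0/2}^{\ell_0/2}|D^{n+1}\zeta(\tau,\cdot)|^2d\eta\le K_n .$$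
   Context: Fix $\ell_0>0$. Functions are $\ell_0$-periodic on $[-\ell_0/2,\ell_0/2]$, and $D=D_\eta$. $\{w_k\}$ is the orthonormal eigenbasis of $D_{\eta\eta}$ with periodic boundary conditions, $D_{\eta\eta}w_k=-\lambda_kw_k$, $\lambda_0=0$, $\lambda_{2j-1}=\lambda_{2j}=4\pi^2j^2/\ell_0^2$. $H^s_\sharp$ is the periodic Sobolev space. An operator with symbol $(c_k)$ acts by $\widehat{(\mathscr Cf)}(k)=c_k\widehat f(k)$. With $X_{\varepsilon,k}=\sqrt{1+4\varepsilon\lambda_k}$, the operators $B_\varepsilon,F_\varepsilon,H_\varepsilon,M_\varepsilon$ have the symbols $$b_{\varepsilon,k}=X_{\varepsilon,k}^2+(1+\varepsilon)X_{\varepsilon,k}-1-\varepsilon,\qquad f_{\varepsilon,k}=\tfrac14(X_{\varepsilon,k}^3-3X_{\varepsilon,k}^2-4(1+\varepsilon)X_{\varepsilon,k}+4+4\varepsilon),$$ $$h_{\varepsilon,k}=\tfrac1\varepsilon(X_{\varepsilon,k}^2+(1+\varepsilon)X_{\varepsilon,k}-2-\varepsilon),\qquad m_{\varepsilon,k}=\tfrac1{4\varepsilon}(X_{\varepsilon,k}^3-3X_{\varepsilon,k}^2-4(1+\varepsilon)X_{\varepsilon,k}+6+4\varepsilon),$$ and $S=-4D^4-D^2$. For $T_1>0$, $$\mathscr Y_n(T_1)=\{\zeta\in C([0,T_1];H^{\max(4,2n)}_\sharp)\cap C^1([0,T_1];L^2):\ \zeta_\tau\in C([0,T_1];H^{\max(2,n+1)}_\sharp)\}.$$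 *)

theory Defs
  imports "HOL-Analysis.Analysis"
begin

text \<open>Functions of the space variable eta are real functions, considered on the
period cell [-l0/2, l0/2]. Fourier analysis uses the complex exponential basis
exp(2 pi i k eta / l0), k integer; the eigenvalue of -D_etaeta on mode k is
4 pi^2 k^2 / l0^2, which is exactly the eigenvalue list lambda_j of the real basis w_j.\<close>

definition lam :: "real \<Rightarrow> int \<Rightarrow> real" where
  "lam l0 k = 4 * pi^2 * (real_of_int k)^2 / l0^2"

definition dsym :: "real \<Rightarrow> int \<Rightarrow> complex" where
  "dsym l0 k = \<i> * complex_of_real (2 * pi * real_of_int k / l0)"

definition L2 :: "real \<Rightarrow> (real \<Rightarrow> real) \<Rightarrow> bool" where
  "L2 l0 f \<longleftrightarrow> f measurable_on {-l0/2..l0/2} \<and> (\<lambda>x. (f x)^2) integrable_on {-l0/2..l0/2}"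

definition fcoef :: "real \<Rightarrow> (real \<Rightarrow> real) \<Rightarrow> int \<Rightarrow> complex" where
  "fcoef l0 f k = integral {-l0/2..l0/2}
      (\<lambda>x. complex_of_real (f x) * cis (- 2 * pi * real_of_int k * x / l0)) / complex_of_real l0"

definition Hs :: "real \<Rightarrow> nat \<Rightarrow> (real \<Rightarrow> real) \<Rightarrow> bool" where
  "Hs l0 s f \<longleftrightarrow> L2 l0 f \<and>
     (\<lambda>k. (1 + lam l0 k)^s * (cmod (fcoef l0 f k))^2) summable_on (UNIV :: int set)"

definition hsn :: "real \<Rightarrow> nat \<Rightarrow> (real \<Rightarrow> real) \<Rightarrow> real" where
  "hsn l0 s f = (\<Sum>\<^sub>\<infinity>k\<in>(UNIV :: int set). (1 + lam l0 k)^s * (cmod (fcoef l0 f k))^2)"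

definition cont_Hs :: "real \<Rightarrow> nat \<Rightarrow> real \<Rightarrow> real \<Rightarrow> (real \<Rightarrow> real \<Rightarrow> real) \<Rightarrow> bool" where
  "cont_Hs l0 s a b u \<longleftrightarrow> (\<forall>t\<in>{a..b}. Hs l0 s (u t)) \<and>
     (\<forall>t\<in>{a..b}. ((\<lambda>t'. hsn l0 s (\<lambda>x. u t' x - u t x)) \<longlongrightarrow> 0) (at t within {a..b}))"

definition deriv_L2 :: "real \<Rightarrow> real \<Rightarrow> real \<Rightarrow> (real \<Rightarrow> real \<Rightarrow> real) \<Rightarrow> (real \<Rightarrow> real \<Rightarrow> real) \<Rightarrow> bool" where
  "deriv_L2 l0 a b u u' \<longleftrightarrow> cont_Hs l0 0 a b u \<and> cont_Hs l0 0 a b u' \<and>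
     (\<forall>t\<in>{a..b}. ((\<lambda>t'. hsn l0 0 (\<lambda>x. (u t' x - u t x) / (t' - t) - u' t x)) \<longlongrightarrow> 0)
                    (at t within {a..b}))"

definition Yn :: "real \<Rightarrow> nat \<Rightarrow> real \<Rightarrow> (real \<Rightarrow> real \<Rightarrow> real) \<Rightarrow> (real \<Rightarrow> real \<Rightarrow> real) \<Rightarrow> bool" where
  "Yn l0 n T1 z z' \<longleftrightarrow> cont_Hs l0 (max 4 (2*n)) 0 T1 z \<and> deriv_L2 l0 0 T1 z z' \<and>
     cont_Hs l0 (max 2 (n+1)) 0 T1 z'"

definition wder :: "real \<Rightarrow> nat \<Rightarrow> (real \<Rightarrow> real) \<Rightarrow> (real \<Rightarrow> real) \<Rightarrow> bool" where
  "wder l0 m f g \<longleftrightarrow> L2 l0 g \<and> (\<forall>k. fcoef l0 g k = (dsym l0 k)^m * fcoef l0 f k)"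

definition Xs :: "real \<Rightarrow> real \<Rightarrow> int \<Rightarrow> real" where
  "Xs l0 e k = sqrt (1 + 4 * e * lam l0 k)"

definition bsym :: "real \<Rightarrow> real \<Rightarrow> int \<Rightarrow> real" where
  "bsym l0 e k = (Xs l0 e k)^2 + (1 + e) * Xs l0 e k - 1 - e"

definition fsym :: "real \<Rightarrow> real \<Rightarrow> int \<Rightarrow> real" where
  "fsym l0 e k = ((Xs l0 e k)^3 - 3 * (Xs l0 e k)^2 - 4 * (1 + e) * Xs l0 e k + 4 + 4 * e) / 4"

definition hsym :: "real \<Rightarrow> real \<Rightarrow> int \<Rightarrow> real" where
  "hsym l0 e k = ((Xs l0 e k)^2 + (1 + e) * Xs l0 e k - 2 - e) / e"

definition msym :: "real \<Rightarrow> real \<Rightarrow> int \<Rightarrow> real" where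
  "msym l0 e k = ((Xs l0 e k)^3 - 3 * (Xs l0 e k)^2 - 4 * (1 + e) * Xs l0 e k + 6 + 4 * e) / (4 * e)"

text \<open>Symbol of S = -4 D^4 - D^2.\<close>
definition ssym :: "real \<Rightarrow> int \<Rightarrow> real" where
  "ssym l0 k = - 4 * (lam l0 k)^2 + lam l0 k"

definition KS_sol :: "real \<Rightarrow> real \<Rightarrow> (real \<Rightarrow> real \<Rightarrow> real) \<Rightarrow> (real \<Rightarrow> real \<Rightarrow> real)
                       \<Rightarrow> (real \<Rightarrow> real \<Rightarrow> real) \<Rightarrow> bool" where
  "KS_sol l0 T Phi Phi' Psi \<longleftrightarrow> deriv_L2 l0 0 T Phi Phi' \<and>
     (\<forall>t\<in>{0..T}. wder l0 1 (Phi t) (Psi t)) \<and>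
     (\<forall>t\<in>{0..T}. \<forall>k. fcoef l0 (Phi' t) k
        + complex_of_real (4 * (lam l0 k)^2 - lam l0 k) * fcoef l0 (Phi t) k
        + fcoef l0 (\<lambda>x. (Psi t x)^2) k / 2 = 0)"

definition eq_star :: "real \<Rightarrow> real \<Rightarrow> real \<Rightarrow> (real \<Rightarrow> real \<Rightarrow> real) \<Rightarrow> (real \<Rightarrow> real \<Rightarrow> real)
                        \<Rightarrow> (real \<Rightarrow> real \<Rightarrow> real) \<Rightarrow> (real \<Rightarrow> real \<Rightarrow> real) \<Rightarrow> bool" where
  "eq_star l0 e T1 z z' Psi Psi' \<longleftrightarrow>
     (\<forall>t\<in>{0..T1}. \<forall>k.
        complex_of_real (bsym l0 e k) * fcoef l0 (z' t) k
        + complex_of_real (hsym l0 e k) * fcoef l0 (Psi' t) k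
      = complex_of_real (ssym l0 k) * fcoef l0 (z t) k
        + complex_of_real (msym l0 e k) * dsym l0 k * fcoef l0 (\<lambda>x. (Psi t x)^2) k
        + complex_of_real (e * fsym l0 e k) * dsym l0 k * fcoef l0 (\<lambda>x. (z t x)^2) k
        + complex_of_real (2 * fsym l0 e k) * dsym l0 k * fcoef l0 (\<lambda>x. Psi t x * z t x) k)"

end

theory Submission
  imports Defs
begin

text \<open>The proof is an energy estimate carried out on the Fourier side. With the weights
  \<open>w = sqrt (1 + \<lambda>)\<close> one has \<open>b \<ge> max 1 (\<epsilon> w\<^sup>2)\<close>, \<open>\<bar>h\<bar> \<le> 12 w\<^sup>2\<close>, \<open>\<bar>m d\<bar> \<le> 39 w\<^sup>4\<close>,
  \<open>\<bar>f d\<bar> \<le> w + 39 \<epsilon> w\<^sup>4\<close>, and the symbol of \<open>S\<close> is at most \<open>6 - 2 w\<^sup>4\<close>. Hence the energy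
  \<open>E = \<Sum> w\<^sup>2\<^sup>n b \<bar>\<zeta>\<bar>\<^sup>2\<close> dominates both quantities to be estimated, and in \<open>dE/d\<tau>\<close> the dissipation
  \<open>\<Sum> w\<^sup>2\<^sup>n\<^sup>+\<^sup>4 \<bar>\<zeta>\<bar>\<^sup>2\<close> absorbs the source terms and, for small \<open>\<epsilon>\<close>, the part \<open>39 \<epsilon> w\<^sup>4\<close> of \<open>f d\<close>, as long
  as \<open>\<epsilon> E\<close> stays bounded. What remains is \<open>dE/d\<tau> \<le> c E + c'\<close> with constants independent of \<open>\<epsilon>\<close>,
  and a continuation argument closes the estimate when \<open>\<epsilon>\<close> is small. Convolutions of coefficients
  are bounded by Schur's test. The energy is truncated to a finite set of modes whose complement
  carries, uniformly in time, at most a unit of dissipation, so that no infinite series has to be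
  differentiated.\<close>

subsection \<open>Uniqueness of Fourier coefficients\<close>

text \<open>The equation is known mode by mode, but its nonlinear terms are coefficients of products
  of functions. The convolution formula that opens them up rests on uniqueness of Fourier
  coefficients: a function with summable coefficients has to agree almost everywhere with its
  trigonometric series. The weight \<open>b\<close> in the energy is forced, since the time
  derivative acts on \<open>B \<zeta>\<close>; it is also what brings in the derivative of order n+1
  with its factor \<epsilon>. The main obstacle is that \<open>f d\<close> has the same order as the
  dissipation and acts on a product containing the unknown. Its top-order part carries a factor
  \<epsilon>, but absorbing it also takes an l1 bound on the coefficients of
  \<open>\<epsilon> \<zeta>\<close> that is uniform in \<epsilon>. Only the energy supplies one, so
  the differential inequality is conditional on the bound to be proved. The order of choices
  matters: the l1 bound \<open>P\<close> and the energy level \<open>M\<close> depend only on the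
  period, \<open>n\<close>, \<open>T\<close> and \<open>Psi\<close>; the threshold for \<epsilon>
  comes after them. The finite set of modes depends on the solution, but no constant depends on that
  set.\<close>

abbreviation (input) cell :: "real \<Rightarrow> real set" where
  "cell l \<equiv> {-l/2..l/2}"

definition cfcoef :: "real \<Rightarrow> (real \<Rightarrow> complex) \<Rightarrow> int \<Rightarrow> complex" where
  "cfcoef l h k = integral (cell l) (\<lambda>x. h x * cis (- 2 * pi * real_of_int k * x / l)) / complex_of_real l"

lemma fcoef_eq_cfcoef: "fcoef l f k = cfcoef l (\<lambda>x. complex_of_real (f x)) k"
  by (simp add: fcoef_def cfcoef_def)

lemma absolutely_integrable_mult_continuous:
  fixes h :: "real \<Rightarrow> complex"
  assumes "h absolutely_integrable_on cell l" "continuous_on (cell l) \<phi>"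
  shows "(\<lambda>x. h x * \<phi> x) absolutely_integrable_on cell l"
proof -
  have "(\<lambda>x. \<phi> x * h x) absolutely_integrable_on cell l"
  proof (rule absolutely_integrable_bounded_measurable_product[OF bilinear_times _ _ _ assms(1)])
    show "\<phi> \<in> borel_measurable (lebesgue_on (cell l))"
      by (rule continuous_imp_measurable_on_sets_lebesgue[OF assms(2)]) simp
    show "bounded (\<phi> ` cell l)"
      by (rule compact_imp_bounded[OF compact_continuous_image[OF assms(2)]]) simp
  qed simp
  then show ?thesis by (simp add: mult.commute)
qed

lemma absolutely_integrable_mult_cis:
  assumes "h absolutely_integrable_on cell l"
  shows "(\<lambda>x. h x * cis (c * x / l)) absolutely_integrable_on cell l"
proof -
  have "continuous_on (cell l) (\<lambda>x. cis ((c / l) * x))" by (intro continuous_intros)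
  then show ?thesis using absolutely_integrable_mult_continuous[OF assms] by simp
qed

lemma integrable_mult_cis:
  assumes "h absolutely_integrable_on cell l"
  shows "(\<lambda>x. h x * cis (c * x / l)) integrable_on cell l"
  using absolutely_integrable_mult_cis[OF assms] by (rule set_lebesgue_integral_eq_integral(1))

lemma cfcoef_add:
  assumes "h absolutely_integrable_on cell l" "g absolutely_integrable_on cell l"
  shows "cfcoef l (\<lambda>x. h x + g x) k = cfcoef l h k + cfcoef l g k"
  using integral_add[OF integrable_mult_cis[OF assms(1)] integrable_mult_cis[OF assms(2)],
      of "- 2 * pi * k" "- 2 * pi * k"]
  by (simp add: cfcoef_def ring_distribs add_divide_distrib)

lemma cfcoef_cmult: "cfcoef l (\<lambda>x. c * h x) k = c * cfcoef l h k"
  by (simp add: cfcoef_def mult.assoc)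

lemma cfcoef_shift: "cfcoef l (\<lambda>x. h x * cis (2 * pi * real_of_int m * x / l)) k = cfcoef l h (k - m)"
proof -
  have "cis (2 * pi * real_of_int m * x / l) * cis (- 2 * pi * real_of_int k * x / l)
      = cis (- 2 * pi * real_of_int (k - m) * x / l)" for x
    by (simp add: cis_mult) (simp add: algebra_simps diff_divide_distrib)
  then show ?thesis by (simp add: cfcoef_def mult.assoc)
qed

definition fourier_null :: "real \<Rightarrow> (real \<Rightarrow> complex) \<Rightarrow> bool" where
  "fourier_null l u \<longleftrightarrow> u absolutely_integrable_on cell l \<and> (\<forall>k. cfcoef l u k = 0)"

lemma fourier_null_add: "fourier_null l u \<Longrightarrow> fourier_null l v \<Longrightarrow> fourier_null l (\<lambda>x. u x + v x)"
  by (simp add: fourier_null_def cfcoef_add set_integral_add)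

lemma fourier_null_cmult: "fourier_null l u \<Longrightarrow> fourier_null l (\<lambda>x. c * u x)"
  by (simp add: fourier_null_def cfcoef_cmult)

lemma fourier_null_shift: "fourier_null l u \<Longrightarrow> fourier_null l (\<lambda>x. u x * cis (2 * pi * real_of_int m * x / l))"
  using absolutely_integrable_mult_cis[where h = u and l = l and c = "2 * pi * real_of_int m"] by (simp add: fourier_null_def cfcoef_shift)

text \<open>A real linear form on the plane is a combination of \<open>z\<close> and
  \<open>cnj z\<close>, which on the circle are the characters of frequency 1 and -1, and these only
  shift the vanishing coefficients. Products are handled by applying the two factors in turn, hence
  the arbitrary \<open>u\<close>.\<close>

lemma fourier_null_polynomial:
  assumes "real_polynomial_function p"
  shows "fourier_null l u \<Longrightarrow> fourier_null l (\<lambda>x. u x * complex_of_real (p (cis (2 * pi * x / l))))"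
  using assms
proof (induction p arbitrary: u)
  case (linear f)
  define a b where "a = complex_of_real (f 1)" and "b = complex_of_real (f \<i>)"
  have fz: "complex_of_real (f z) = ((a - \<i> * b) / 2) * z + ((a + \<i> * b) / 2) * cnj z" for z
  proof -
    have z: "z = Re z *\<^sub>R 1 + Im z *\<^sub>R \<i>" by (simp add: complex_eq_iff)
    have "f z = Re z * f 1 + Im z * f \<i>"
      by (subst z) (simp only: linear_simps[OF linear.hyps] real_scaleR_def)
    then show ?thesis by (simp add: a_def b_def complex_eq_iff field_simps)
  qed
  have "fourier_null l (\<lambda>x. ((a - \<i> * b) / 2) * (u x * cis (2 * pi * real_of_int 1 * x / l)) +
     ((a + \<i> * b) / 2) * (u x * cis (2 * pi * real_of_int (-1) * x / l)))"
    by (intro fourier_null_add fourier_null_cmult fourier_null_shift linear.prems)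
  moreover have "(\<lambda>x. ((a - \<i> * b) / 2) * (u x * cis (2 * pi * real_of_int 1 * x / l)) +
     ((a + \<i> * b) / 2) * (u x * cis (2 * pi * real_of_int (-1) * x / l)))
     = (\<lambda>x. u x * complex_of_real (f (cis (2 * pi * x / l))))"
    by (rule ext, subst fz) (simp add: cis_cnj algebra_simps)
  ultimately show ?case by simp
next
  case (const c)
  from fourier_null_cmult[OF const, of "of_real c"] show ?case by (simp add: mult.commute)
next
  case (add f g)
  from fourier_null_add[OF add.IH(1)[OF add.prems] add.IH(2)[OF add.prems]] show ?case
    by (simp add: algebra_simps)
next
  case (mult f g)
  from mult.IH(2)[OF mult.IH(1)[OF mult.prems]] show ?case by (simp add: mult.assoc)
qed

lemma integral_fourier_null: "l > 0 \<Longrightarrow> fourier_null l u \<Longrightarrow> integral (cell l) u = 0"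
  unfolding fourier_null_def cfcoef_def by (auto dest!: spec[of _ 0])

text \<open>A periodic function descends to the circle, where Stone-Weierstrass applies.\<close>

lemma periodic_uniform_approx:
  fixes \<phi> :: "real \<Rightarrow> real"
  assumes l: "l > 0" and \<phi>: "continuous_on (cell l) \<phi>" "\<phi> (-l/2) = \<phi> (l/2)" and e: "e > 0"
  obtains p where "real_polynomial_function p"
    "\<And>x. x \<in> cell l \<Longrightarrow> \<bar>\<phi> x - p (cis (2 * pi * x / l))\<bar> < e"
proof -
  define q where "q x = cis (2 * pi * x / l)" for x
  have q: "continuous_on (cell l) q" unfolding q_def using l by (auto intro!: continuous_intros)
  \<comment> \<open>The map \<open>q\<close> identifies the two endpoints of the closed cell and
    nothing else, and there the periodicity assumption applies.\<close>
  have eqq: "\<phi> x = \<phi> y" if "x \<in> cell l" "y \<in> cell l" "q x = q y" for x y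
  proof (cases "x = y")
    case False
    have "cis (2 * pi * (x - y) / l) = 1"
      using that(3) unfolding q_def
      by (metis (no_types, lifting) cis_divide cis_neq_zero diff_divide_distrib divide_self right_diff_distrib)
    then obtain n :: int where n: "2 * pi * (x - y) / l = of_int n * 2 * pi"
      by (metis cis.simps(1) cos_one_2pi_int one_complex.simps(1))
    then have "(2 * pi) * (x - y) = (2 * pi) * (of_int n * l)" using l by (simp add: field_simps)
    then have xy: "x - y = of_int n * l" by simp
    have "\<bar>x - y\<bar> \<le> l" using that by auto
    then have "\<bar>real_of_int n\<bar> \<le> 1" using xy l by (simp add: abs_mult)
    then have "n = 1 \<or> n = -1" using False xy by (cases "n = 0") auto
    then have "(x = l/2 \<and> y = -l/2) \<or> (x = -l/2 \<and> y = l/2)" using that xy by auto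
    then show ?thesis using \<phi>(2) by auto
  qed simp
  \<comment> \<open>A continuous surjection from a compact space onto a Hausdorff space is a
    quotient map, so \<open>\<phi>\<close> factors through a continuous function on the
    circle.\<close>
  have qm: "quotient_map (top_of_set (cell l)) (top_of_set (q ` cell l)) q"
  proof (rule T1_Spaces.continuous_imp_quotient_map)
    show "continuous_map (top_of_set (cell l)) (top_of_set (q ` cell l)) q"
      using q by (intro continuous_map_into_subtopology) (auto simp: image_subset_iff)
    show "compact_space (top_of_set (cell l))" by (simp add: compact_space_subtopology)
    show "Hausdorff_space (top_of_set (q ` cell l))"
      by (rule Hausdorff_space_subtopology[OF Hausdorff_space_euclidean])
  qed simp
  have cm: "continuous_map (top_of_set (cell l)) euclideanreal \<phi>"
    using \<phi>(1) by (simp only: continuous_map_iff_continuous)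
  have lift: "\<phi> x = \<phi> y" if "x \<in> topspace (top_of_set (cell l))"
    "y \<in> topspace (top_of_set (cell l))" "q x = q y" for x y
    using that by (intro eqq) (simp_all only: topspace_euclidean_subtopology)
  obtain h where h: "continuous_map (top_of_set (q ` cell l)) euclideanreal h"
      "\<And>x. x \<in> topspace (top_of_set (cell l)) \<Longrightarrow> h (q x) = \<phi> x"
    by (rule quotient_map_lift_exists[OF qm cm], rule lift, assumption, assumption, assumption, rule that)
  have h2: "h (q x) = \<phi> x" if "x \<in> cell l" for x
    using h(2) that by (simp only: topspace_euclidean_subtopology)
  have qc: "compact (q ` cell l)" by (rule compact_continuous_image[OF q]) simp
  have hc: "continuous_on (q ` cell l) h"
    using h(1) by (simp only: continuous_map_iff_continuous)
  obtain p where p: "real_polynomial_function p" "\<And>z. z \<in> q ` cell l \<Longrightarrow> \<bar>h z - p z\<bar> < e"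
    by (rule Stone_Weierstrass_real_polynomial_function[OF qc hc e]) (rule that)
  show ?thesis
  proof (rule that[OF p(1)])
    fix x assume x: "x \<in> cell l"
    show "\<bar>\<phi> x - p (cis (2 * pi * x / l))\<bar> < e"
      using p(2)[OF imageI[OF x]] unfolding h2[OF x] by (simp only: q_def)
  qed
qed

text \<open>Trigonometric polynomials are annihilated by \<open>u\<close>, and replacing
  \<open>\<phi>\<close> by one of them costs at most the uniform error times the L1 norm of
  \<open>u\<close>.\<close>

lemma fourier_null_orthogonal_continuous:
  fixes \<phi> :: "real \<Rightarrow> real"
  assumes l: "l > 0" and u: "fourier_null l u" and \<phi>: "continuous_on (cell l) \<phi>" "\<phi> (-l/2) = \<phi> (l/2)"
  shows "integral (cell l) (\<lambda>x. u x * complex_of_real (\<phi> x)) = 0"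
proof -
  have ai: "u absolutely_integrable_on cell l" using u by (simp add: fourier_null_def)
  define N where "N = integral (cell l) (\<lambda>x. norm (u x))"
  have N: "(\<lambda>x. norm (u x)) integrable_on cell l" using ai by (simp add: absolutely_integrable_on_def)
  then have N0: "N \<ge> 0" unfolding N_def by (rule integral_nonneg) simp
  have "norm (integral (cell l) (\<lambda>x. u x * complex_of_real (\<phi> x))) \<le> e" if e: "e > 0" for e
  proof -
    \<comment> \<open>The norm \<open>N\<close> may vanish, hence the divisor
      \<open>N + 1\<close>.\<close>
    have "e / (N + 1) > 0" using e N0 by simp
    then obtain p where p: "real_polynomial_function p"
      "\<And>x. x \<in> cell l \<Longrightarrow> \<bar>\<phi> x - p (cis (2 * pi * x / l))\<bar> < e / (N + 1)"
      using periodic_uniform_approx[OF l \<phi>] by blast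
    define P where "P x = complex_of_real (p (cis (2 * pi * x / l)))" for x
    have np: "fourier_null l (\<lambda>x. u x * P x)" unfolding P_def by (rule fourier_null_polynomial[OF p(1) u])
    then have i1: "(\<lambda>x. u x * P x) integrable_on cell l"
      by (simp add: fourier_null_def absolutely_integrable_on_def)
    have "continuous_on (cell l) (\<lambda>x. complex_of_real (\<phi> x))" by (intro continuous_intros \<phi>)
    then have i2: "(\<lambda>x. u x * complex_of_real (\<phi> x)) integrable_on cell l"
      using absolutely_integrable_mult_continuous[OF ai] by (simp add: absolutely_integrable_on_def)
    have "integral (cell l) (\<lambda>x. u x * complex_of_real (\<phi> x))
        = integral (cell l) (\<lambda>x. u x * complex_of_real (\<phi> x) - u x * P x)"
      using integral_diff[OF i2 i1] integral_fourier_null[OF l np] by simp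
    also have "norm \<dots> \<le> integral (cell l) (\<lambda>x. e / (N + 1) * norm (u x))"
    proof (rule integral_norm_bound_integral)
      show "(\<lambda>x. u x * complex_of_real (\<phi> x) - u x * P x) integrable_on cell l"
        by (rule integrable_diff[OF i2 i1])
      show "(\<lambda>x. e / (N + 1) * norm (u x)) integrable_on cell l"
        using N by (rule integrable_on_mult_right)
      fix x assume x: "x \<in> cell l"
      have "norm (u x * complex_of_real (\<phi> x) - u x * P x) = norm (u x) * \<bar>\<phi> x - p (cis (2 * pi * x / l))\<bar>"
        unfolding P_def by (metis norm_mult norm_of_real of_real_diff right_diff_distrib real_norm_def)
      also have "\<dots> \<le> norm (u x) * (e / (N + 1))"
        using p(2)[OF x] by (intro mult_left_mono) auto
      finally show "norm (u x * complex_of_real (\<phi> x) - u x * P x) \<le> e / (N + 1) * norm (u x)"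
        by (simp add: mult.commute)
    qed
    also have "\<dots> = e / (N + 1) * N" by (simp add: N_def)
    also have "\<dots> \<le> e" using N0 e by (simp add: field_simps)
    finally show ?thesis .
  qed
  then have "norm (integral (cell l) (\<lambda>x. u x * complex_of_real (\<phi> x))) \<le> 0"
    by (rule field_le_epsilon) simp
  then show ?thesis by simp
qed


text \<open>Tested against \<open>v / (1 + \<bar>v\<bar>)\<close> with \<open>v = Re u\<close>, a function orthogonal to all
  continuous periodic functions must satisfy \<open>v = 0\<close> almost everywhere. The approximants of \<open>v\<close>
  come from the definition of measurability; the cutoff makes them periodic.\<close>

lemma fourier_null_negligible_Re:
  assumes l: "l > 0" and u: "fourier_null l u"
  shows "negligible {x \<in> cell l. Re (u x) \<noteq> 0}"
proof -
  have ai: "u absolutely_integrable_on cell l" using u by (simp add: fourier_null_def)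
  define v where "v x = Re (u x)" for x
  have "u \<in> borel_measurable (lebesgue_on (cell l))"
    using ai absolutely_integrable_measurable[of "cell l" u] by simp
  then have "v \<in> borel_measurable (lebesgue_on (cell l))"
    unfolding v_def
    by (rule measurable_compose[OF _ borel_measurable_continuous_onI[OF continuous_on_Re[OF continuous_on_id]]])
  then have "v measurable_on cell l" by (simp add: measurable_on_iff_borel_measurable)
  then obtain N g where N: "negligible N" and g: "\<And>n. continuous_on UNIV (g n)"
    and lim: "\<And>x. x \<notin> N \<Longrightarrow> (\<lambda>n. g n x) \<longlonglongrightarrow> (if x \<in> cell l then v x else 0)"
    unfolding measurable_on_def by metis
  \<comment> \<open>At the endpoints the cutoff is zero for every \<open>n\<close>, so convergence
    fails there; they join the exceptional null set.\<close>
  define N' where "N' = N \<union> {-l/2, l/2}"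
  have N': "negligible N'" unfolding N'_def using N by (simp add: negligible_Un)
  define cut where "cut n x = max 0 (min 1 (real n * (l/2 - \<bar>x\<bar>)))" for n x
  \<comment> \<open>The quotient is bounded by 1 whatever \<open>g n\<close> does, so
    \<open>norm (u x)\<close> dominates all the products. As \<open>u\<close> is merely integrable,
    \<open>v\<close> itself could not serve as a test function.\<close>
  define \<phi> where "\<phi> n x = g n x / (1 + \<bar>g n x\<bar>) * cut n x" for n x
  have \<phi>c: "continuous_on (cell l) (\<phi> n)" for n
    unfolding \<phi>_def cut_def using continuous_on_subset[OF g]
    by (intro continuous_intros) auto
  have \<phi>1: "\<bar>\<phi> n x\<bar> \<le> 1" for n x
  proof -
    have "\<bar>g n x / (1 + \<bar>g n x\<bar>)\<bar> \<le> 1" "\<bar>cut n x\<bar> \<le> 1" by (auto simp: cut_def)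
    then show ?thesis unfolding \<phi>_def abs_mult by (intro mult_le_one) auto
  qed
  define U where "U n x = u x * complex_of_real (\<phi> n x)" for n x
  have U_int: "U n integrable_on cell l" for n
  proof -
    have "continuous_on (cell l) (\<lambda>x. complex_of_real (\<phi> n x))" by (intro continuous_intros \<phi>c)
    then show ?thesis unfolding U_def
      using absolutely_integrable_mult_continuous[OF ai] by (simp add: absolutely_integrable_on_def)
  qed
  have U0: "integral (cell l) (U n) = 0" for n
    unfolding U_def using l
    by (intro fourier_null_orthogonal_continuous[OF l u \<phi>c]) (simp add: \<phi>_def cut_def)
  \<comment> \<open>Zero on the null set, so that the convergence holds at every point of the cell,
    as the dominated convergence theorem asks.\<close>
  define V where "V n x = (if x \<in> N' then 0 else U n x)" for n x
  define V' where "V' x = (if x \<in> N' then 0 else u x * complex_of_real (v x / (1 + \<bar>v x\<bar>)))" for x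
  have V_int: "V n integrable_on cell l" for n
    by (rule integrable_spike[OF U_int N']) (auto simp: V_def)
  have V0: "integral (cell l) (V n) = 0" for n
    using integral_spike[OF N', of "cell l" "V n" "U n"] U0 by (auto simp: V_def)
  have V_le: "norm (V n x) \<le> norm (u x)" for n x
    using \<phi>1[of n x] by (auto simp: V_def U_def norm_mult mult_left_le)
  have conv: "(\<lambda>n. V n x) \<longlonglongrightarrow> V' x" if x: "x \<in> cell l" for x
  proof (cases "x \<in> N'")
    case False
    then have xl: "\<bar>x\<bar> < l/2" and xN: "x \<notin> N" using x by (auto simp: N'_def)
    have "eventually (\<lambda>n. cut n x = 1) sequentially"
    proof -
      obtain m :: nat where m: "1 / (l/2 - \<bar>x\<bar>) < real m" using reals_Archimedean2 by blast
      have "cut n x = 1" if "n \<ge> m" for n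
      proof -
        have "1 / (l/2 - \<bar>x\<bar>) < real n" using m that by linarith
        then have "1 \<le> real n * (l/2 - \<bar>x\<bar>)" using xl by (simp add: field_simps)
        then show ?thesis by (simp add: cut_def)
      qed
      then show ?thesis by (auto simp: eventually_sequentially)
    qed
    then have "(\<lambda>n. cut n x) \<longlonglongrightarrow> 1" by (rule tendsto_eventually)
    moreover have "(\<lambda>n. g n x) \<longlonglongrightarrow> v x" using lim[OF xN] x by simp
    ultimately have "(\<lambda>n. \<phi> n x) \<longlonglongrightarrow> v x / (1 + \<bar>v x\<bar>) * 1"
      unfolding \<phi>_def by (intro tendsto_intros) auto
    then have "(\<lambda>n. u x * complex_of_real (\<phi> n x)) \<longlonglongrightarrow> u x * complex_of_real (v x / (1 + \<bar>v x\<bar>))"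
      by (intro tendsto_intros) simp
    then show ?thesis using False by (simp add: V_def V'_def U_def)
  qed (simp add: V_def V'_def)
  have nu: "(\<lambda>x. norm (u x)) integrable_on cell l" using ai by (simp add: absolutely_integrable_on_def)
  note dc = dominated_convergence[of V "cell l" "\<lambda>x. norm (u x)" V', OF V_int nu V_le conv]
  have "integral (cell l) V' = 0"
    using LIMSEQ_unique[OF dc(2)] V0 by simp
  then have "(V' has_integral 0) (cell l)" using dc(1) by (simp add: has_integral_iff)
  from has_integral_linear[OF this bounded_linear_Re]
  have R0: "((\<lambda>x. Re (V' x)) has_integral 0) (cell l)" by (simp add: o_def)
  \<comment> \<open>The real part of the limit is nonnegative and has integral zero, which forces
    \<open>v = 0\<close> almost everywhere.\<close>
  have Re_V': "Re (V' x) = (if x \<in> N' then 0 else (v x)^2 / (1 + \<bar>v x\<bar>))" for x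
    by (simp add: V'_def v_def power2_eq_square)
  have nn: "Re (V' x) \<ge> 0" for x by (simp add: Re_V')
  have "(\<lambda>x. Re (V' x)) absolutely_integrable_on cell l"
    using R0 nn by (intro nonnegative_absolutely_integrable_1) auto
  then have iV: "integrable (lebesgue_on (cell l)) (\<lambda>x. Re (V' x))"
    by (simp add: set_integrable_def integrable_restrict_space)
  have "integral\<^sup>L (lebesgue_on (cell l)) (\<lambda>x. Re (V' x)) = 0"
    using lebesgue_integral_eq_integral[OF iV] R0 by (simp add: has_integral_iff)
  then have "AE x in lebesgue_on (cell l). Re (V' x) = 0"
    using integral_nonneg_eq_0_iff_AE[OF iV] nn by simp
  then have "AE x in lebesgue. x \<in> cell l \<longrightarrow> Re (V' x) = 0"
    by (simp add: AE_restrict_space_iff)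
  then obtain Z where Z: "Z \<in> null_sets lebesgue" "{x. \<not> (x \<in> cell l \<longrightarrow> Re (V' x) = 0)} \<subseteq> Z"
    unfolding eventually_ae_filter by auto
  have "negligible (Z \<union> N')" using Z(1) N' by (simp add: negligible_iff_null_sets null_sets.Un)
  moreover have "{x \<in> cell l. Re (u x) \<noteq> 0} \<subseteq> Z \<union> N'"
    using Z(2) by (fastforce simp: Re_V' v_def split: if_splits)
  ultimately show ?thesis by (rule negligible_subset)
qed

lemma fourier_null_negligible:
  assumes l: "l > 0" and u: "fourier_null l u"
  shows "negligible {x \<in> cell l. u x \<noteq> 0}"
proof -
  have "negligible {x \<in> cell l. Re (- \<i> * u x) \<noteq> 0}"
    by (rule fourier_null_negligible_Re[OF l fourier_null_cmult[OF u]])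
  with fourier_null_negligible_Re[OF l u]
  have "negligible ({x \<in> cell l. Re (u x) \<noteq> 0} \<union> {x \<in> cell l. Re (- \<i> * u x) \<noteq> 0})"
    by (rule negligible_Un)
  then show ?thesis by (rule negligible_subset) (auto simp: complex_eq_iff)
qed

subsection \<open>Convolution of Fourier coefficients\<close>

lemma norm_cfcoef_le:
  assumes "l > 0" "h absolutely_integrable_on cell l" "(\<lambda>x. B * g x) integrable_on cell l"
    and "\<And>x. x \<in> cell l \<Longrightarrow> norm (h x) \<le> B * g x"
  shows "norm (cfcoef l h k) \<le> B * (integral (cell l) g / l)"
proof -
  have "norm (integral (cell l) (\<lambda>x. h x * cis ((- 2 * pi * real_of_int k) * x / l)))
      \<le> integral (cell l) (\<lambda>x. B * g x)"
    using assms(4)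
    by (intro integral_norm_bound_integral integrable_mult_cis assms(2,3)) (simp add: norm_mult)
  then show ?thesis using assms(1)
    by (simp add: cfcoef_def norm_divide divide_right_mono)
qed

lemma cfcoef_sum_mult:
  assumes "finite F" "h absolutely_integrable_on cell l"
  shows "cfcoef l (\<lambda>x. h x * (\<Sum>j\<in>F. c j * cis (2 * pi * real_of_int j * x / l))) k
    = (\<Sum>j\<in>F. c j * cfcoef l h (k - j))"
  using assms(1)
proof (induction F)
  case empty
  then show ?case by (simp add: cfcoef_def)
next
  case (insert i F)
  have a: "(\<lambda>x. h x * (\<Sum>j\<in>G. c j * cis (2 * pi * real_of_int j * x / l))) absolutely_integrable_on cell l" for G
  proof (rule absolutely_integrable_mult_continuous[OF assms(2)])
    have "continuous_on (cell l) (\<lambda>x. \<Sum>j\<in>G. c j * cis ((2 * pi * real_of_int j / l) * x))"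
      by (intro continuous_intros)
    then show "continuous_on (cell l) (\<lambda>x. \<Sum>j\<in>G. c j * cis (2 * pi * real_of_int j * x / l))" by simp
  qed
  have "cfcoef l (\<lambda>x. h x * (\<Sum>j\<in>insert i F. c j * cis (2 * pi * real_of_int j * x / l))) k
      = cfcoef l (\<lambda>x. h x * (\<Sum>j\<in>{i}. c j * cis (2 * pi * real_of_int j * x / l))
          + h x * (\<Sum>j\<in>F. c j * cis (2 * pi * real_of_int j * x / l))) k"
    using insert by (simp add: ring_distribs)
  also have "\<dots> = cfcoef l (\<lambda>x. h x * (\<Sum>j\<in>{i}. c j * cis (2 * pi * real_of_int j * x / l))) k
      + (\<Sum>j\<in>F. c j * cfcoef l h (k - j))"
    by (subst cfcoef_add[OF a a]) (simp add: insert)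
  also have "cfcoef l (\<lambda>x. h x * (\<Sum>j\<in>{i}. c j * cis (2 * pi * real_of_int j * x / l))) k
      = cfcoef l (\<lambda>x. c i * (h x * cis (2 * pi * real_of_int i * x / l))) k"
    by (simp add: mult_ac)
  also have "\<dots> = c i * cfcoef l h (k - i)"
    by (simp only: cfcoef_cmult cfcoef_shift)
  finally show ?case using insert by simp
qed

section \<open>Absolutely convergent trigonometric series\<close>

definition trig_series :: "real \<Rightarrow> (int \<Rightarrow> complex) \<Rightarrow> real \<Rightarrow> complex" where
  "trig_series l c x = (\<Sum>\<^sub>\<infinity>k. c k * cis (2 * pi * real_of_int k * x / l))"

lemma uniform_limit_trig_series:
  assumes "(\<lambda>k. cmod (c k)) summable_on UNIV"
  shows "uniform_limit UNIV (\<lambda>F x. \<Sum>k\<in>F. c k * cis (2 * pi * real_of_int k * x / l))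
    (trig_series l c) (finite_subsets_at_top UNIV)"
  unfolding trig_series_def
  by (rule Weierstrass_m_test_general[OF _ assms]) (simp add: norm_mult)

lemma continuous_on_trig_series:
  assumes "(\<lambda>k. cmod (c k)) summable_on UNIV"
  shows "continuous_on UNIV (trig_series l c)"
proof (rule uniform_limit_theorem[OF _ uniform_limit_trig_series[OF assms]])
  have "continuous_on UNIV (\<lambda>x. \<Sum>k\<in>F. c k * cis ((2 * pi * real_of_int k / l) * x))" for F
    by (intro continuous_intros)
  then show "\<forall>\<^sub>F F in finite_subsets_at_top UNIV.
      continuous_on UNIV (\<lambda>x. \<Sum>k\<in>F. c k * cis (2 * pi * real_of_int k * x / l))"
    by simp
qed simp

lemma absolutely_integrable_mult_trig_series:
  assumes "(\<lambda>k. cmod (c k)) summable_on UNIV" "h absolutely_integrable_on cell l"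
  shows "(\<lambda>x. h x * trig_series l c x) absolutely_integrable_on cell l"
  using continuous_on_subset[OF continuous_on_trig_series[OF assms(1)]]
  by (intro absolutely_integrable_mult_continuous[OF assms(2)]) auto

text \<open>For a finite partial sum the convolution formula is linearity plus shifting. The partial
  sums converge uniformly and \<open>h\<close> is integrable, so the coefficients of the products
  converge too.\<close>

lemma has_sum_cfcoef_mult_trig_series:
  assumes l: "l > 0" and c: "(\<lambda>k. cmod (c k)) summable_on UNIV"
    and h: "h absolutely_integrable_on cell l"
  shows "((\<lambda>j. c j * cfcoef l h (k - j)) has_sum cfcoef l (\<lambda>x. h x * trig_series l c x) k) UNIV"
  unfolding has_sum_def
proof (rule tendstoI)
  fix e :: real assume e: "e > 0"
  define S where "S F x = (\<Sum>j\<in>F. c j * cis (2 * pi * real_of_int j * x / l))" for F x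
  define N where "N = integral (cell l) (\<lambda>x. norm (h x)) / l"
  have hn: "(\<lambda>x. norm (h x)) integrable_on cell l" using h by (simp add: absolutely_integrable_on_def)
  have N0: "N \<ge> 0" unfolding N_def
    using l by (intro divide_nonneg_nonneg integral_nonneg[OF hn]) auto
  define d where "d = e / (N + 1)"
  have d: "d > 0" using e N0 by (simp add: d_def)
  have "\<forall>\<^sub>F F in finite_subsets_at_top UNIV. \<forall>x\<in>UNIV. dist (S F x) (trig_series l c x) < d"
    unfolding S_def by (rule uniform_limitD[OF uniform_limit_trig_series[OF c] d])
  moreover have "\<forall>\<^sub>F F in finite_subsets_at_top (UNIV :: int set). finite F"
    by (rule eventually_finite_subsets_at_top_weakI) simp
  ultimately show "\<forall>\<^sub>F F in finite_subsets_at_top UNIV.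
      dist (\<Sum>j\<in>F. c j * cfcoef l h (k - j)) (cfcoef l (\<lambda>x. h x * trig_series l c x) k) < e"
  proof eventually_elim
    case (elim F)
    have a: "(\<lambda>x. h x * S F x) absolutely_integrable_on cell l"
    proof (rule absolutely_integrable_mult_continuous[OF h])
      have "continuous_on (cell l) (\<lambda>x. \<Sum>j\<in>F. c j * cis ((2 * pi * real_of_int j / l) * x))"
        by (intro continuous_intros)
      then show "continuous_on (cell l) (S F)" by (simp add: S_def)
    qed
    note b = absolutely_integrable_mult_trig_series[OF c h]
    have a': "(\<lambda>x. (-1) * (h x * S F x)) absolutely_integrable_on cell l"
      using a by (rule set_integrable_mult_right) 
    have "cfcoef l (\<lambda>x. h x * trig_series l c x) k - (\<Sum>j\<in>F. c j * cfcoef l h (k - j))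
        = cfcoef l (\<lambda>x. h x * trig_series l c x) k + (-1) * cfcoef l (\<lambda>x. h x * S F x) k"
      using cfcoef_sum_mult[OF elim(2) h, of c k] by (simp add: S_def)
    also have "\<dots> = cfcoef l (\<lambda>x. h x * trig_series l c x + (-1) * (h x * S F x)) k"
      by (subst cfcoef_add[OF b a']) (simp only: cfcoef_cmult)
    finally have eq: "cfcoef l (\<lambda>x. h x * trig_series l c x) k - (\<Sum>j\<in>F. c j * cfcoef l h (k - j))
        = cfcoef l (\<lambda>x. h x * trig_series l c x + (-1) * (h x * S F x)) k" .
    have "norm (cfcoef l (\<lambda>x. h x * trig_series l c x + (-1) * (h x * S F x)) k) \<le> d * N"
      unfolding N_def
    proof (rule norm_cfcoef_le[OF l])
      show "(\<lambda>x. h x * trig_series l c x + (-1) * (h x * S F x)) absolutely_integrable_on cell l"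
        by (rule set_integral_add(1)[OF b a'])
      show "(\<lambda>x. d * norm (h x)) integrable_on cell l" by (rule integrable_on_mult_right[OF hn])
      fix x
      have "h x * trig_series l c x + (-1) * (h x * S F x) = h x * (trig_series l c x - S F x)"
        by (simp add: algebra_simps)
      then have "norm (h x * trig_series l c x + (-1) * (h x * S F x))
          = norm (h x) * dist (S F x) (trig_series l c x)"
        by (simp add: norm_mult dist_norm norm_minus_commute)
      also have "\<dots> \<le> norm (h x) * d" using elim(1) by (intro mult_left_mono) (auto intro: less_imp_le)
      finally show "norm (h x * trig_series l c x + (-1) * (h x * S F x)) \<le> d * norm (h x)"
        by (simp add: mult.commute)
    qed
    also have "\<dots> < e" using e N0 by (simp add: d_def field_simps)
    finally show ?case
      unfolding eq[symmetric] by (simp only: dist_norm norm_minus_commute)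
  qed
qed

lemma cfcoef_one:
  assumes l: "l > 0"
  shows "cfcoef l (\<lambda>x. 1) k = (if k = 0 then 1 else 0)"
proof (cases "k = 0")
  case False
  define a where "a = - 2 * pi * real_of_int k / l"
  have a: "a \<noteq> 0" using False l by (simp add: a_def)
  define G where "G x = cis (a * x) / (\<i> * of_real a)" for x
  have "(G has_vector_derivative cis (a * x)) (at x within cell l)" for x
    unfolding G_def has_vector_derivative_def using a
    by (auto intro!: derivative_eq_intros simp: scaleR_conv_of_real field_simps)
  then have "((\<lambda>x. cis (a * x)) has_integral G (l/2) - G (-l/2)) (cell l)"
    using l by (intro fundamental_theorem_of_calculus) auto
  moreover have "G (l/2) = G (-l/2)"
  proof -
    have "cis (a * (l/2)) = cis (a * (-l/2)) * cis (a * l)"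
      by (simp add: cis_mult)
    also have "a * l = 2 * pi * real_of_int (-k)" using l by (simp add: a_def)
    also have "cis \<dots> = 1" by (rule cis_multiple_2pi) simp
    finally show ?thesis by (simp add: G_def)
  qed
  ultimately have "((\<lambda>x. cis (a * x)) has_integral 0) (cell l)" by simp
  then have "((\<lambda>x. cis (- 2 * pi * real_of_int k * x / l)) has_integral 0) (cell l)"
    by (simp add: a_def)
  then show ?thesis using False by (simp add: cfcoef_def integral_unique)
qed (use l in \<open>simp add: cfcoef_def scaleR_conv_of_real\<close>)

text \<open>The convolution formula with \<open>h = 1\<close>, whose coefficients form the unit
  sequence at 0.\<close>

lemma cfcoef_trig_series:
  assumes l: "l > 0" and c: "(\<lambda>k. cmod (c k)) summable_on UNIV"
  shows "cfcoef l (trig_series l c) k = c k"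
proof -
  have "(\<lambda>x. 1 :: complex) absolutely_integrable_on cell l"
    using absolutely_integrable_on_const[of "cell l" "1 :: complex"] by simp
  from has_sum_cfcoef_mult_trig_series[OF l c this, of k]
  have "((\<lambda>j. c j * cfcoef l (\<lambda>x. 1) (k - j)) has_sum cfcoef l (trig_series l c) k) UNIV"
    by (simp only: mult_1)
  moreover have "c j * cfcoef l (\<lambda>x. 1) (k - j) = (if j = k then c j else 0)" for j
    by (simp add: cfcoef_one[OF l])
  ultimately have "((\<lambda>j. if j = k then c j else 0) has_sum cfcoef l (trig_series l c) k) UNIV"
    by (simp only:)
  moreover have "((\<lambda>j. if j = k then c j else 0) has_sum c k) UNIV"
    by (rule has_sum_finite_neutralI[of "{k}"]) auto
  ultimately show ?thesis by (rule has_sum_unique)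
qed

text \<open>The difference of the two sides has only zero coefficients, so uniqueness applies. This
  is what turns information on coefficients back into information on values, and thereby gives
  access to products.\<close>

lemma fourier_series_ae:
  assumes l: "l > 0" and h: "h absolutely_integrable_on cell l"
    and c: "(\<lambda>k. cmod (cfcoef l h k)) summable_on UNIV"
  shows "negligible {x \<in> cell l. h x \<noteq> trig_series l (cfcoef l h) x}"
proof -
  have one: "(\<lambda>x. 1 :: complex) absolutely_integrable_on cell l"
    using absolutely_integrable_on_const[of "cell l" "1 :: complex"] by simp
  from absolutely_integrable_mult_trig_series[OF c one]
  have t: "trig_series l (cfcoef l h) absolutely_integrable_on cell l" by simp
  then have t': "(\<lambda>x. (-1) * trig_series l (cfcoef l h) x) absolutely_integrable_on cell l"
    by (rule set_integrable_mult_right)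
  have "fourier_null l (\<lambda>x. h x + (-1) * trig_series l (cfcoef l h) x)"
    unfolding fourier_null_def
  proof (intro conjI allI set_integral_add(1)[OF h t'])
    fix k show "cfcoef l (\<lambda>x. h x + (-1) * trig_series l (cfcoef l h) x) k = 0"
      by (subst cfcoef_add[OF h t'], subst cfcoef_cmult) (simp add: cfcoef_trig_series[OF l c])
  qed
  from fourier_null_negligible[OF l this] show ?thesis by simp
qed

section \<open>Products of square-integrable functions\<close>

lemma L2_imp_measurable: "L2 l f \<Longrightarrow> f \<in> borel_measurable (lebesgue_on (cell l))"
  by (simp add: L2_def measurable_on_iff_borel_measurable)

lemma L2_mult_integrable:
  assumes "L2 l f" "L2 l g"
  shows "(\<lambda>x. complex_of_real (f x) * complex_of_real (g x)) absolutely_integrable_on cell l"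
proof (rule measurable_bounded_by_integrable_imp_absolutely_integrable)
  show "(\<lambda>x. complex_of_real (f x) * complex_of_real (g x)) \<in> borel_measurable (lebesgue_on (cell l))"
    by (rule borel_measurable_times;
        rule measurable_compose[OF L2_imp_measurable borel_measurable_continuous_onI[OF continuous_on_of_real_id]];
        fact)
  show "(\<lambda>x. (f x)^2 + (g x)^2) integrable_on cell l"
    using assms by (intro integrable_add) (auto simp: L2_def)
  fix x
  have "0 \<le> \<bar>f x\<bar> * \<bar>g x\<bar>" by simp
  then show "norm (complex_of_real (f x) * complex_of_real (g x)) \<le> (f x)^2 + (g x)^2"
    using sum_squares_bound[of "\<bar>f x\<bar>" "\<bar>g x\<bar>"]
    unfolding norm_mult norm_of_real power2_abs by linarith
qed simp

lemma L2_const: "L2 l (\<lambda>x. c)"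
  unfolding L2_def by (auto intro: integrable_const_ivl)

lemma L2_integrable: "L2 l f \<Longrightarrow> (\<lambda>x. complex_of_real (f x)) absolutely_integrable_on cell l"
  using L2_mult_integrable[OF _ L2_const[of l 1]] by simp

text \<open>Under the integral \<open>f\<close> may be replaced by its series, since the two agree
  almost everywhere. The roles are asymmetric: summability is asked of one factor, the other is only
  square-integrable.\<close>

lemma fcoef_mult_has_sum:
  assumes l: "l > 0" and f: "L2 l f" and g: "L2 l g"
    and sm: "(\<lambda>k. cmod (fcoef l f k)) summable_on UNIV"
  shows "((\<lambda>j. fcoef l f j * fcoef l g (k - j)) has_sum fcoef l (\<lambda>x. f x * g x) k) UNIV"
proof -
  let ?f = "\<lambda>x. complex_of_real (f x)" and ?g = "\<lambda>x. complex_of_real (g x)"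
  have sm': "(\<lambda>k. cmod (cfcoef l ?f k)) summable_on UNIV" using sm by (simp add: fcoef_eq_cfcoef)
  have "integral (cell l) (\<lambda>x. ?g x * trig_series l (cfcoef l ?f) x * cis (- 2 * pi * real_of_int k * x / l))
      = integral (cell l) (\<lambda>x. ?f x * ?g x * cis (- 2 * pi * real_of_int k * x / l))"
  proof (rule integral_spike[OF fourier_series_ae[OF l L2_integrable[OF f] sm']])
    fix x assume "x \<in> cell l - {x \<in> cell l. ?f x \<noteq> trig_series l (cfcoef l ?f) x}"
    then have "?f x = trig_series l (cfcoef l ?f) x" by blast
    then show "?f x * ?g x * cis (- 2 * pi * real_of_int k * x / l)
      = ?g x * trig_series l (cfcoef l ?f) x * cis (- 2 * pi * real_of_int k * x / l)"
      by (metis mult.commute)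
  qed
  then have "cfcoef l (\<lambda>x. ?g x * trig_series l (cfcoef l ?f) x) k = cfcoef l (\<lambda>x. ?f x * ?g x) k"
    by (simp only: cfcoef_def)
  then show ?thesis
    using has_sum_cfcoef_mult_trig_series[OF l sm' L2_integrable[OF g], of k]
    unfolding fcoef_eq_cfcoef of_real_mult by (simp only:)
qed

subsection \<open>Weights, symbols and Schur's test\<close>

lemma lam_nonneg: "lam l k \<ge> 0"
  by (simp add: lam_def)

lemma lam_eq_square: "lam l k = (2 * pi * real_of_int k / l)^2"
  by (simp add: lam_def power2_eq_square)

lemma cmod_dsym: "cmod (dsym l k) = sqrt (lam l k)"
  unfolding lam_eq_square dsym_def norm_mult norm_of_real by simp

definition wt :: "real \<Rightarrow> int \<Rightarrow> real" where
  "wt l k = sqrt (1 + lam l k)"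

lemma wt_ge_1: "wt l k \<ge> 1"
  using lam_nonneg[of l k] by (simp add: wt_def)

lemma wt_nonneg [simp]: "wt l k \<ge> 0"
  using wt_ge_1[of l k] by simp

lemma wt_power2: "(wt l k)^2 = 1 + lam l k"
  using lam_nonneg[of l k] by (simp add: wt_def)

lemma wt_power_even: "(wt l k)^(2 * s) = (1 + lam l k)^s"
  by (simp add: power_mult wt_power2)

text \<open>The weight is the Euclidean norm of the plane vector with entries 1 and the frequency;
  the triangle inequality is applied to \<open>(1, x)\<close> and \<open>(0, y)\<close>.\<close>

lemma wt_add_le: "wt l (i + j) \<le> wt l i + wt l j"
proof -
  let ?x = "2 * pi * real_of_int i / l" and ?y = "2 * pi * real_of_int j / l"
  have "wt l (i + j) = sqrt ((1 + 0)^2 + (?x + ?y)^2)"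
    by (simp add: wt_def lam_eq_square ring_distribs add_divide_distrib)
  also have "\<dots> \<le> sqrt (1^2 + ?x^2) + sqrt (0^2 + ?y^2)"
    by (rule real_sqrt_sum_squares_triangle_ineq)
  also have "\<dots> \<le> wt l i + wt l j"
    unfolding wt_def lam_eq_square by (intro add_mono real_sqrt_le_mono) auto
  finally show ?thesis .
qed

lemma wt_power_add_le: "(wt l (i + j))^r \<le> 2^r * ((wt l i)^r + (wt l j)^r)"
proof -
  have "wt l (i + j) \<le> 2 * max (wt l i) (wt l j)" using wt_add_le[of l i j] by linarith
  then have "(wt l (i + j))^r \<le> (2 * max (wt l i) (wt l j))^r" by (intro power_mono) auto
  also have "\<dots> = 2^r * (max (wt l i) (wt l j))^r" by (simp add: power_mult_distrib)
  also have "(max (wt l i) (wt l j))^r \<le> (wt l i)^r + (wt l j)^r" by (auto simp: max_def)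
  finally show ?thesis by simp
qed

text \<open>The crude companion of the additive bound: both factors carry the full weight at once.
  It suits products with \<open>Psi\<close>, which has derivatives to spare, but not the square of
  the unknown.\<close>

lemma wt_power_add_le_mult: "(wt l (i + j))^r \<le> 2^r * ((wt l i)^r * (wt l j)^r)"
proof -
  have "wt l i * 1 \<le> wt l i * wt l j" "1 * wt l j \<le> wt l i * wt l j"
    by (intro mult_left_mono mult_right_mono wt_ge_1 wt_nonneg)+
  then have "wt l (i + j) \<le> 2 * (wt l i * wt l j)" using wt_add_le[of l i j] by linarith
  then have "(wt l (i + j))^r \<le> (2 * (wt l i * wt l j))^r" by (intro power_mono) auto
  then show ?thesis by (simp add: power_mult_distrib)
qed

lemma wt_power_mono: "r \<le> s \<Longrightarrow> (wt l k)^r \<le> (wt l k)^s"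
  by (intro power_increasing wt_ge_1)

lemma summable_on_int_nat:
  fixes f :: "int \<Rightarrow> real"
  assumes "(\<lambda>n. f (int n)) summable_on UNIV" "(\<lambda>n. f (- int n)) summable_on UNIV"
  shows "f summable_on UNIV"
proof -
  have "f summable_on range int" "f summable_on range (\<lambda>n. - int n)"
    using assms by (subst summable_on_reindex; simp add: inj_def o_def)+
  then have "f summable_on (range int \<union> range (\<lambda>n. - int n))" by (rule summable_on_union)
  moreover have "range int \<union> range (\<lambda>n. - int n) = UNIV"
    by (auto simp: image_iff) (metis int_cases2)
  ultimately show ?thesis by simp
qed

lemma summable_inverse_wt:
  assumes "l > 0"
  shows "(\<lambda>k. 1 / (wt l k)^2) summable_on UNIV"
proof -
  define c where "c = 4 * pi^2 / l^2"
  have c: "c > 0" using assms by (simp add: c_def)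
  have lam: "lam l k = c * (real_of_int k)^2" for k by (simp add: lam_def c_def)
  have "(\<lambda>n. 1 / (1 + c * (real n)^2)) summable_on UNIV"
  proof (rule summable_nonneg_imp_summable_on)
    have s: "summable (\<lambda>n. (1 / c) * inverse ((real n)^2))"
      by (intro summable_mult inverse_power_summable) simp
    show "summable (\<lambda>n. 1 / (1 + c * (real n)^2))"
    proof (rule summable_comparison_test'[OF s, of 1])
      fix n :: nat assume n: "n \<ge> 1"
      have "1 / (1 + c * (real n)^2) \<le> 1 / (c * (real n)^2)"
        using n c by (intro divide_left_mono) (auto simp: add_pos_nonneg)
      then show "norm (1 / (1 + c * (real n)^2)) \<le> (1 / c) * inverse ((real n)^2)"
        using c by (simp add: field_simps)
    qed
    show "1 / (1 + c * (real n)^2) \<ge> 0" for n using c by simp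
  qed
  then show ?thesis
    by (intro summable_on_int_nat) (simp_all add: wt_power2 lam)
qed

section \<open>Bounds for the symbols, uniform in \<epsilon>\<close>

lemma Xs_bounds:
  assumes "e > 0" "e \<le> 1"
  shows "Xs l e k \<ge> 1" "(Xs l e k)^2 = 1 + 4 * e * lam l k" "Xs l e k \<le> 3 * wt l k"
proof -
  have el: "e * lam l k \<ge> 0" "e * lam l k \<le> 1 * lam l k"
    using assms lam_nonneg[of l k] by (intro mult_nonneg_nonneg mult_right_mono; simp)+
  then show "Xs l e k \<ge> 1" "(Xs l e k)^2 = 1 + 4 * e * lam l k"
    using el by (auto simp: Xs_def)
  have "1 + 4 * (e * lam l k) \<le> 9 * (1 + lam l k)" using el lam_nonneg[of l k] by simp
  then have "Xs l e k \<le> sqrt (9 * (1 + lam l k))"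
    unfolding Xs_def mult.assoc[of 4] by (rule real_sqrt_le_mono)
  also have "\<dots> = 3 * wt l k" unfolding wt_def real_sqrt_mult by simp
  finally show "Xs l e k \<le> 3 * wt l k" .
qed

text \<open>Here \<open>b = X^2 + (1 + e) * (X - 1)\<close> with \<open>X \<ge> 1\<close>, so
  already \<open>X^2 = 1 + 4 * e * lam\<close> lies below it. The first bound yields the estimate at
  level n, the second the \<epsilon>-weighted one at level n+1.\<close>

lemma bsym_ge:
  assumes "e > 0" "e \<le> 1"
  shows "bsym l e k \<ge> 1" "bsym l e k \<ge> e * (wt l k)^2"
proof -
  note X = Xs_bounds[OF assms, of l k]
  have "(1 + e) * (Xs l e k - 1) \<ge> 0" using X(1) assms by simp
  then have *: "bsym l e k \<ge> 1 + 4 * e * lam l k"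
    using X(2) by (simp add: bsym_def algebra_simps)
  have "e * lam l k \<ge> 0" using assms lam_nonneg[of l k] by simp
  then show "bsym l e k \<ge> 1" "bsym l e k \<ge> e * (wt l k)^2"
    using * assms by (auto simp: wt_power2 algebra_simps)
qed

text \<open>The factor \<open>1 / e\<close> is harmless because the numerator vanishes at
  \<open>X = 1\<close>: it equals \<open>(X - 1) * (X + 2 + e)\<close>, while
  \<open>(X - 1) * (X + 1) = 4 * e * lam\<close>. The remaining quotient
  \<open>(X + 2 + e) / (X + 1)\<close> is at most 3.\<close>

lemma hsym_bound:
  assumes "e > 0" "e \<le> 1"
  shows "\<bar>hsym l e k\<bar> \<le> 12 * (wt l k)^2"
proof -
  note X = Xs_bounds[OF assms, of l k]
  define x where "x = Xs l e k"
  have x: "x \<ge> 1" "4 * e * lam l k = (x - 1) * (x + 1)"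
    using X by (auto simp: x_def power2_eq_square algebra_simps)
  have "e * (hsym l e k * (x + 1)) = (x - 1) * (x + 1) * (x + 2 + e)"
    using assms by (simp add: hsym_def x_def[symmetric]) (simp add: power2_eq_square algebra_simps)
  also have "\<dots> = e * (4 * lam l k * (x + 2 + e))" by (simp add: x(2)[symmetric])
  finally have h: "hsym l e k * (x + 1) = 4 * lam l k * (x + 2 + e)" using assms by simp
  then have "hsym l e k = 4 * lam l k * (x + 2 + e) / (x + 1)" using x by (simp add: field_simps)
  then have h0: "hsym l e k \<ge> 0" using x assms lam_nonneg[of l k] by simp
  have "4 * lam l k * (x + 2 + e) \<le> 4 * lam l k * (3 * (x + 1))"
    using x assms lam_nonneg[of l k] by (intro mult_left_mono) auto
  then have "hsym l e k * (x + 1) \<le> (12 * lam l k) * (x + 1)" unfolding h by (simp add: algebra_simps)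
  then have "hsym l e k \<le> 12 * lam l k" using x by (simp add: mult_le_cancel_right)
  then show ?thesis using h0 by (simp add: wt_power2)
qed

text \<open>Again \<open>X - 1\<close> divides the numerator, with cofactor
  \<open>X^2 - 2 * X - 6 - 4 * e\<close>, and the factor \<open>e\<close> cancels. The cofactor is
  at most \<open>13 * X^2\<close>, where 13 = 1 + 2 + 6 + 4, and \<open>X \<le> 3 * wt\<close> turns
  13 into 39.\<close>

lemma msym_bound:
  assumes "e > 0" "e \<le> 1"
  shows "\<bar>msym l e k\<bar> * sqrt (lam l k) \<le> 39 * (wt l k)^4"
proof -
  note X = Xs_bounds[OF assms, of l k]
  define x where "x = Xs l e k"
  have x: "x \<ge> 1" "4 * e * lam l k = (x - 1) * (x + 1)"
    using X by (auto simp: x_def power2_eq_square algebra_simps)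
  have "4 * e * (msym l e k * (x + 1)) = (x - 1) * (x + 1) * (x^2 - 2 * x - 6 - 4 * e)"
    using assms by (simp add: msym_def x_def[symmetric]) (simp add: power2_eq_square power3_eq_cube algebra_simps)
  also have "\<dots> = 4 * e * (lam l k * (x^2 - 2 * x - 6 - 4 * e))" by (simp add: x(2)[symmetric])
  finally have m: "msym l e k * (x + 1) = lam l k * (x^2 - 2 * x - 6 - 4 * e)" using assms by simp
  have "x \<le> x^2" using x by (simp add: power2_eq_square)
  then have "\<bar>x^2 - 2 * x - 6 - 4 * e\<bar> \<le> 13 * x^2" using x assms by linarith
  also have "\<dots> \<le> 13 * x * (x + 1)" using x by (simp add: power2_eq_square algebra_simps)
  finally have "lam l k * \<bar>x^2 - 2 * x - 6 - 4 * e\<bar> \<le> lam l k * (13 * x * (x + 1))"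
    using lam_nonneg by (rule mult_left_mono)
  moreover have "\<bar>msym l e k\<bar> * (x + 1) = lam l k * \<bar>x^2 - 2 * x - 6 - 4 * e\<bar>"
    using arg_cong[OF m, of abs] x lam_nonneg[of l k] by (simp add: abs_mult)
  ultimately have "\<bar>msym l e k\<bar> * (x + 1) \<le> (13 * lam l k * x) * (x + 1)" by (simp add: algebra_simps)
  then have "\<bar>msym l e k\<bar> \<le> 13 * lam l k * x" using x by (simp add: mult_le_cancel_right)
  also have "\<dots> \<le> 13 * (wt l k)^2 * (3 * wt l k)"
    using X(3) x lam_nonneg[of l k] by (intro mult_mono) (auto simp: x_def wt_power2)
  finally have "\<bar>msym l e k\<bar> * sqrt (lam l k) \<le> (13 * (wt l k)^2 * (3 * wt l k)) * wt l k"
    using lam_nonneg[of l k] by (intro mult_mono) (auto simp: wt_def)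
  then show ?thesis by (simp add: power2_eq_square power4_eq_xxxx mult.assoc)
qed

text \<open>The identity \<open>f = e * m - 1/2\<close> separates a part of order one, harmless for
  every \<epsilon>, from a part of order four with a factor \<epsilon>.\<close>

lemma fsym_bound:
  assumes "e > 0" "e \<le> 1"
  shows "\<bar>fsym l e k\<bar> * sqrt (lam l k) \<le> wt l k + 39 * e * (wt l k)^4"
proof -
  have "fsym l e k = e * msym l e k - 1/2"
    using assms by (simp add: fsym_def msym_def field_simps)
  then have "\<bar>fsym l e k\<bar> \<le> e * \<bar>msym l e k\<bar> + 1"
    using assms abs_triangle_ineq4[of "e * msym l e k" "1/2"] by (simp add: abs_mult)
  then have "\<bar>fsym l e k\<bar> * sqrt (lam l k) \<le> (e * \<bar>msym l e k\<bar> + 1) * sqrt (lam l k)"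
    using lam_nonneg[of l k] by (intro mult_right_mono) auto
  also have "\<dots> = e * (\<bar>msym l e k\<bar> * sqrt (lam l k)) + sqrt (lam l k)" by (simp add: algebra_simps)
  also have "\<dots> \<le> e * (39 * (wt l k)^4) + wt l k"
    using assms msym_bound[OF assms, of l k] by (intro add_mono mult_left_mono) (auto simp: wt_def)
  finally show ?thesis by (simp add: algebra_simps)
qed

text \<open>The right side exceeds the left by \<open>2 * lam^2 - 5 * lam + 4 > 0\<close>, with
  \<open>lam\<close> the eigenvalue. Half of the fourth-order damping is given up, which pays for
  the antidissipative second-order term and for passing from \<open>lam\<close> to the
  weight.\<close>

lemma ssym_le: "ssym l k \<le> 6 - 2 * (wt l k)^4"
proof -
  have "(wt l k)^4 = (1 + lam l k)^2"
    using wt_power_even[of l k 2] by simp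
  moreover have "0 \<le> 2 * (lam l k - 5/4)^2" by simp
  ultimately show ?thesis by (simp add: ssym_def power2_eq_square algebra_simps)
qed

section \<open>Schur's test for convolutions\<close>

lemma summable_on_shift:
  fixes p :: "int \<Rightarrow> real"
  assumes "p summable_on UNIV"
  shows "(\<lambda>j. p (k - j)) summable_on UNIV" "(\<Sum>\<^sub>\<infinity>j. p (k - j)) = (\<Sum>\<^sub>\<infinity>j. p j)"
proof -
  have b: "bij_betw (\<lambda>j. k - j) UNIV (UNIV :: int set)"
    by (rule bij_betwI[of _ _ _ "\<lambda>j. k - j"]) auto
  show "(\<lambda>j. p (k - j)) summable_on UNIV"
    using summable_on_reindex_bij_betw[OF b, of p] assms by simp
  show "(\<Sum>\<^sub>\<infinity>j. p (k - j)) = (\<Sum>\<^sub>\<infinity>j. p j)"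
    using infsum_reindex_bij_betw[OF b, of p] by simp
qed

lemma le_infsum:
  fixes p :: "int \<Rightarrow> real"
  assumes "p summable_on UNIV" "\<And>k. p k \<ge> 0"
  shows "p k \<le> infsum p UNIV"
  using finite_sum_le_infsum[OF assms(1), of "{k}"] assms(2) by simp

lemma convolution_summable:
  fixes p y :: "int \<Rightarrow> real"
  assumes p: "p summable_on UNIV" "\<And>k. p k \<ge> 0" and y: "(\<lambda>k. (y k)^2) summable_on UNIV" "\<And>k. y k \<ge> 0"
  shows "(\<lambda>j. p (k - j) * (y j)^2) summable_on UNIV" "(\<lambda>j. p (k - j) * y j) summable_on UNIV"
proof -
  show 1: "(\<lambda>j. p (k - j) * (y j)^2) summable_on UNIV"
    by (rule summable_on_comparison_test[OF summable_on_cmult_right[OF y(1), of "infsum p UNIV"]])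
      (auto intro!: mult_right_mono mult_nonneg_nonneg le_infsum p)
  \<comment> \<open>A square-summable \<open>y\<close> need not be summable; this reduces the claim
    to a translate of \<open>p\<close> and the claim just shown.\<close>
  have "y j \<le> 1 + (y j)^2" for j
    using y(2)[of j] sum_squares_bound[of 1 "y j"] by simp
  then have "p (k - j) * y j \<le> p (k - j) * (1 + (y j)^2)" for j
    using p(2) by (intro mult_left_mono) auto
  then have "p (k - j) * y j \<le> p (k - j) + p (k - j) * (y j)^2" for j
    by (simp add: algebra_simps)
  then show "(\<lambda>j. p (k - j) * y j) summable_on UNIV"
    using p y by (intro summable_on_comparison_test[OF summable_on_add[OF summable_on_shift(1)[OF p(1)] 1]]) auto
qed

lemma infsum_sum_finite:
  fixes f :: "'b \<Rightarrow> 'a \<Rightarrow> real"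
  assumes "finite F" "\<And>k. k \<in> F \<Longrightarrow> f k summable_on A"
  shows "(\<lambda>j. \<Sum>k\<in>F. f k j) summable_on A" "(\<Sum>\<^sub>\<infinity>j\<in>A. \<Sum>k\<in>F. f k j) = (\<Sum>k\<in>F. infsum (f k) A)"
  using assms by (induction F) (auto simp: summable_on_add infsum_add)

text \<open>Young's inequality splits each product, and \<open>p (k - j)\<close> is summable in
  \<open>j\<close> for fixed \<open>k\<close> and in \<open>k\<close> for fixed \<open>j\<close>.
  The left side is a finite sum because the energy is truncated, while the convolution still sees
  all modes of \<open>y\<close>. The parameters \<open>\<alpha>\<close>, \<open>\<beta>\<close>
  allow the part in \<open>x\<close> to be made exactly as small as the dissipation
  requires.\<close>

lemma schur_bound:
  fixes p x y :: "int \<Rightarrow> real"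
  assumes F: "finite F" and p: "p summable_on UNIV" "\<And>k. p k \<ge> 0" "infsum p UNIV \<le> P"
    and y: "(\<lambda>k. (y k)^2) summable_on UNIV" "\<And>k. y k \<ge> 0" and x: "\<And>k. x k \<ge> 0"
    and ab: "\<alpha> > 0" "\<beta> > 0" "1 \<le> 4 * \<alpha> * \<beta>"
  shows "(\<Sum>k\<in>F. x k * (\<Sum>\<^sub>\<infinity>j. p (k - j) * y j))
    \<le> P * (\<alpha> * (\<Sum>\<^sub>\<infinity>k. (y k)^2) + \<beta> * (\<Sum>k\<in>F. (x k)^2))"
proof -
  have amgm: "b * a \<le> \<alpha> * a^2 + \<beta> * b^2" if "a \<ge> 0" "b \<ge> 0" for a b :: real
  proof -
    have "0 \<le> (2 * \<alpha> * a - b)^2" by simp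
    then have "4 * \<alpha> * (b * a) \<le> 4 * \<alpha> * (\<alpha> * a^2) + b^2" by (simp add: power2_eq_square algebra_simps)
    also have "\<dots> \<le> 4 * \<alpha> * (\<alpha> * a^2) + (4 * \<alpha> * \<beta>) * b^2"
      using ab mult_right_mono[OF ab(3), of "b^2"] by simp
    also have "\<dots> = 4 * \<alpha> * (\<alpha> * a^2 + \<beta> * b^2)" by (simp add: algebra_simps)
    finally show ?thesis using ab by simp
  qed
  have k: "x k * (\<Sum>\<^sub>\<infinity>j. p (k - j) * y j)
      \<le> \<alpha> * (\<Sum>\<^sub>\<infinity>j. p (k - j) * (y j)^2) + \<beta> * infsum p UNIV * (x k)^2" for k
  proof -
    have s1: "(\<lambda>j. \<alpha> * (p (k - j) * (y j)^2)) summable_on UNIV"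
      by (intro summable_on_cmult_right convolution_summable p y)
    have s2: "(\<lambda>j. \<beta> * (x k)^2 * p (k - j)) summable_on UNIV"
      by (intro summable_on_cmult_right summable_on_shift p)
    have "x k * (\<Sum>\<^sub>\<infinity>j. p (k - j) * y j) = (\<Sum>\<^sub>\<infinity>j. x k * (p (k - j) * y j))"
      by (rule infsum_cmult_right[symmetric]) (rule convolution_summable[OF p(1,2) y])
    also have "\<dots> \<le> (\<Sum>\<^sub>\<infinity>j. \<alpha> * (p (k - j) * (y j)^2) + \<beta> * (x k)^2 * p (k - j))"
    proof (rule infsum_mono)
      show "(\<lambda>j. x k * (p (k - j) * y j)) summable_on UNIV"
        by (intro summable_on_cmult_right convolution_summable[OF p(1,2) y])
      show "(\<lambda>j. \<alpha> * (p (k - j) * (y j)^2) + \<beta> * (x k)^2 * p (k - j)) summable_on UNIV"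
        by (rule summable_on_add[OF s1 s2])
      fix j
      show "x k * (p (k - j) * y j) \<le> \<alpha> * (p (k - j) * (y j)^2) + \<beta> * (x k)^2 * p (k - j)"
        using mult_left_mono[OF amgm[OF y(2)[of j] x[of k]] p(2)[of "k - j"]]
        by (simp add: algebra_simps)
    qed
    also have "\<dots> = \<alpha> * (\<Sum>\<^sub>\<infinity>j. p (k - j) * (y j)^2) + \<beta> * (x k)^2 * (\<Sum>\<^sub>\<infinity>j. p (k - j))"
      by (subst infsum_add[OF s1 s2]) (simp add: infsum_cmult_right')
    finally show ?thesis by (simp add: summable_on_shift(2)[OF p(1)] mult_ac)
  qed
  have "(\<Sum>k\<in>F. \<Sum>\<^sub>\<infinity>j. p (k - j) * (y j)^2) = (\<Sum>\<^sub>\<infinity>j. \<Sum>k\<in>F. p (k - j) * (y j)^2)"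
    by (rule infsum_sum_finite(2)[symmetric, OF F]) (rule convolution_summable(1)[OF p(1,2) y])
  also have "\<dots> \<le> (\<Sum>\<^sub>\<infinity>j. infsum p UNIV * (y j)^2)"
  proof (rule infsum_mono)
    show "(\<lambda>j. \<Sum>k\<in>F. p (k - j) * (y j)^2) summable_on UNIV"
      by (rule infsum_sum_finite(1)[OF F]) (rule convolution_summable(1)[OF p(1,2) y])
    show "(\<lambda>j. infsum p UNIV * (y j)^2) summable_on UNIV"
      by (intro summable_on_cmult_right y)
    fix j
    \<comment> \<open>For fixed \<open>j\<close> the indices \<open>k - j\<close> are distinct, so
      the finite sum is part of the full series.\<close>
    have "(\<Sum>k\<in>F. p (k - j)) = sum p ((\<lambda>k. k - j) ` F)"
      by (subst sum.reindex) (auto simp: inj_on_def)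
    also have "\<dots> \<le> infsum p UNIV"
      by (rule finite_sum_le_infsum) (use p F in auto)
    finally show "(\<Sum>k\<in>F. p (k - j) * (y j)^2) \<le> infsum p UNIV * (y j)^2"
      unfolding sum_distrib_right[symmetric] by (rule mult_right_mono) simp
  qed
  also have "\<dots> = infsum p UNIV * (\<Sum>\<^sub>\<infinity>k. (y k)^2)" by (rule infsum_cmult_right')
  finally have *: "(\<Sum>k\<in>F. \<Sum>\<^sub>\<infinity>j. p (k - j) * (y j)^2) \<le> infsum p UNIV * (\<Sum>\<^sub>\<infinity>k. (y k)^2)" .
  have "(\<Sum>k\<in>F. x k * (\<Sum>\<^sub>\<infinity>j. p (k - j) * y j))
      \<le> (\<Sum>k\<in>F. \<alpha> * (\<Sum>\<^sub>\<infinity>j. p (k - j) * (y j)^2) + \<beta> * infsum p UNIV * (x k)^2)"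
    by (rule sum_mono) (rule k)
  also have "\<dots> = \<alpha> * (\<Sum>k\<in>F. \<Sum>\<^sub>\<infinity>j. p (k - j) * (y j)^2) + \<beta> * infsum p UNIV * (\<Sum>k\<in>F. (x k)^2)"
    by (simp add: sum.distrib sum_distrib_left)
  also have "\<dots> \<le> \<alpha> * (infsum p UNIV * (\<Sum>\<^sub>\<infinity>k. (y k)^2)) + \<beta> * infsum p UNIV * (\<Sum>k\<in>F. (x k)^2)"
    using * ab by simp
  also have "\<dots> = infsum p UNIV * (\<alpha> * (\<Sum>\<^sub>\<infinity>k. (y k)^2) + \<beta> * (\<Sum>k\<in>F. (x k)^2))"
    by (simp add: algebra_simps)
  also have "\<dots> \<le> P * (\<alpha> * (\<Sum>\<^sub>\<infinity>k. (y k)^2) + \<beta> * (\<Sum>k\<in>F. (x k)^2))"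
    using p(3) ab by (intro mult_right_mono add_nonneg_nonneg mult_nonneg_nonneg infsum_nonneg sum_nonneg) auto
  finally show ?thesis .
qed

subsection \<open>Sobolev norms and curves in Sobolev spaces\<close>

lemma fcoef_minus: "fcoef l f (- k) = cnj (fcoef l f k)"
  unfolding fcoef_def by (simp add: integral_cnj cis_cnj)

lemma L2_diff:
  assumes "L2 l f" "L2 l g"
  shows "L2 l (\<lambda>x. f x - g x)"
  unfolding L2_def
proof
  show m: "(\<lambda>x. f x - g x) measurable_on cell l"
    using assms by (intro measurable_on_diff) (auto simp: L2_def)
  show "(\<lambda>x. (f x - g x)^2) integrable_on cell l"
  proof (rule measurable_bounded_by_integrable_imp_integrable)
    show "(\<lambda>x. (f x - g x)^2) \<in> borel_measurable (lebesgue_on (cell l))"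
      using m by (intro borel_measurable_power) (simp add: measurable_on_iff_borel_measurable)
    show "(\<lambda>x. 2 * (f x)^2 + 2 * (g x)^2) integrable_on cell l"
      using assms by (intro integrable_add integrable_on_mult_right) (auto simp: L2_def)
    fix x
    have "0 \<le> (f x + g x)^2" by simp
    then have "(f x - g x)^2 \<le> 2 * (f x)^2 + 2 * (g x)^2"
      by (simp add: power2_eq_square algebra_simps)
    then show "norm ((f x - g x)^2) \<le> 2 * (f x)^2 + 2 * (g x)^2" by simp
  qed simp
qed

lemma L2_cmult:
  assumes "L2 l f"
  shows "L2 l (\<lambda>x. c * f x)"
proof -
  have "(\<lambda>x. c *\<^sub>R f x) measurable_on cell l"
    by (rule measurable_on_scaleR_const) (use assms in \<open>simp add: L2_def\<close>)
  then show ?thesis using assms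
    by (auto simp: L2_def power_mult_distrib intro!: integrable_on_mult_right)
qed

lemma fcoef_cmult: "fcoef l (\<lambda>x. c * f x) k = complex_of_real c * fcoef l f k"
  using cfcoef_cmult[of l "complex_of_real c" "\<lambda>x. complex_of_real (f x)" k]
  by (simp add: fcoef_eq_cfcoef)

lemma fcoef_diff:
  assumes "L2 l f" "L2 l g"
  shows "fcoef l (\<lambda>x. f x - g x) k = fcoef l f k - fcoef l g k"
  using cfcoef_add[OF L2_integrable[OF assms(1)] L2_integrable[OF L2_cmult[OF assms(2), of "-1"]], of k]
    cfcoef_cmult[of l "-1" "\<lambda>x. complex_of_real (g x)" k]
  by (simp add: fcoef_eq_cfcoef)

lemma wt_term: "(1 + lam l k)^s * (cmod c)^2 = ((wt l k)^s * cmod c)^2"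
  by (simp add: power_mult_distrib wt_power_even[symmetric] power_mult[symmetric] mult.commute)

lemma Hs_iff: "Hs l s f \<longleftrightarrow> L2 l f \<and> (\<lambda>k. ((wt l k)^s * cmod (fcoef l f k))^2) summable_on UNIV"
  by (simp add: Hs_def wt_term)

lemma hsn_eq: "hsn l s f = (\<Sum>\<^sub>\<infinity>k. ((wt l k)^s * cmod (fcoef l f k))^2)"
  by (simp add: hsn_def wt_term)

lemma hsn_nonneg: "hsn l s f \<ge> 0"
  unfolding hsn_eq by (rule infsum_nonneg) simp

lemma Hs_L2: "Hs l s f \<Longrightarrow> L2 l f"
  by (simp add: Hs_def)

lemma Hs_summable: "Hs l s f \<Longrightarrow> (\<lambda>k. ((wt l k)^s * cmod (fcoef l f k))^2) summable_on A"
  unfolding Hs_iff by (auto intro: summable_on_subset)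

lemma coef_le_hsn:
  assumes "Hs l s f"
  shows "((wt l k)^s * cmod (fcoef l f k))^2 \<le> hsn l s f"
  unfolding hsn_eq using Hs_summable[OF assms] by (intro le_infsum) auto

lemma wt_term_mono: "r \<le> s \<Longrightarrow> ((wt l k)^r * cmod c)^2 \<le> ((wt l k)^s * cmod c)^2"
  by (intro power_mono mult_right_mono wt_power_mono) auto

lemma Hs_mono: "r \<le> s \<Longrightarrow> Hs l s f \<Longrightarrow> Hs l r f"
  unfolding Hs_iff using wt_term_mono by (blast intro: summable_on_comparison_test zero_le_power2)

lemma hsn_mono:
  assumes "r \<le> s" "Hs l s f"
  shows "hsn l r f \<le> hsn l s f"
  unfolding hsn_eq
  by (intro infsum_mono wt_term_mono assms Hs_summable[OF assms(2)] Hs_summable[OF Hs_mono[OF assms]])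

lemma Hs_cmult:
  assumes "Hs l s f"
  shows "Hs l s (\<lambda>x. c * f x)"
proof -
  have "((wt l k)^s * cmod (fcoef l (\<lambda>x. c * f x) k))^2 = c^2 * ((wt l k)^s * cmod (fcoef l f k))^2" for k
    by (simp add: fcoef_cmult norm_mult power_mult_distrib)
  then show ?thesis
    unfolding Hs_iff using L2_cmult[OF Hs_L2[OF assms]] Hs_summable[OF assms]
    by (simp add: summable_on_cmult_right)
qed

lemma sq_le_two: "(a + b)^2 \<le> 2 * a^2 + 2 * (b::real)^2"
  using zero_le_power2[of "a - b"] by (simp add: power2_eq_square algebra_simps)

lemma wt_term_le_diff:
  "((wt l k)^s * cmod a)^2 \<le> 2 * ((wt l k)^s * cmod b)^2 + 2 * ((wt l k)^s * cmod (a - b))^2"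
proof -
  have "(wt l k)^s * cmod a \<le> (wt l k)^s * (cmod b + cmod (a - b))"
    using norm_triangle_ineq[of b "a - b"] by (intro mult_left_mono) auto
  then have "((wt l k)^s * cmod a)^2 \<le> ((wt l k)^s * cmod b + (wt l k)^s * cmod (a - b))^2"
    by (intro power_mono) (auto simp: ring_distribs)
  also have "\<dots> \<le> 2 * ((wt l k)^s * cmod b)^2 + 2 * ((wt l k)^s * cmod (a - b))^2"
    by (rule sq_le_two)
  finally show ?thesis .
qed

lemma Hs_diff:
  assumes "Hs l s f" "Hs l s g"
  shows "Hs l s (\<lambda>x. f x - g x)"
  unfolding Hs_iff
proof
  show "L2 l (\<lambda>x. f x - g x)" using assms by (intro L2_diff) (auto simp: Hs_def)
  have "(\<lambda>k. 2 * ((wt l k)^s * cmod (fcoef l f k))^2 + 2 * ((wt l k)^s * cmod (fcoef l g k))^2) summable_on UNIV"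
    by (intro summable_on_add summable_on_cmult_right Hs_summable assms)
  then show "(\<lambda>k. ((wt l k)^s * cmod (fcoef l (\<lambda>x. f x - g x) k))^2) summable_on UNIV"
  proof (rule summable_on_comparison_test)
    fix k
    show "((wt l k)^s * cmod (fcoef l (\<lambda>x. f x - g x) k))^2
        \<le> 2 * ((wt l k)^s * cmod (fcoef l f k))^2 + 2 * ((wt l k)^s * cmod (fcoef l g k))^2"
      using wt_term_le_diff[of l k s "fcoef l f k - fcoef l g k" "fcoef l f k"]
      by (simp add: fcoef_diff[OF Hs_L2[OF assms(1)] Hs_L2[OF assms(2)]])
  qed simp
qed

text \<open>Stated over an arbitrary index set: all of it gives boundedness along a curve, a
  complement of a finite set gives control of tails.\<close>

lemma infsum_wt_le_diff:
  assumes "Hs l s f" "Hs l s g"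
  shows "(\<Sum>\<^sub>\<infinity>k\<in>A. ((wt l k)^s * cmod (fcoef l f k))^2)
    \<le> 2 * (\<Sum>\<^sub>\<infinity>k\<in>A. ((wt l k)^s * cmod (fcoef l g k))^2) + 2 * hsn l s (\<lambda>x. f x - g x)"
proof -
  let ?d = "\<lambda>x. f x - g x"
  have s: "(\<lambda>k. 2 * ((wt l k)^s * cmod (fcoef l g k))^2) summable_on A"
    "(\<lambda>k. 2 * ((wt l k)^s * cmod (fcoef l ?d k))^2) summable_on A"
    by (intro summable_on_cmult_right Hs_summable Hs_diff assms)+
  have "(\<Sum>\<^sub>\<infinity>k\<in>A. ((wt l k)^s * cmod (fcoef l f k))^2)
      \<le> (\<Sum>\<^sub>\<infinity>k\<in>A. 2 * ((wt l k)^s * cmod (fcoef l g k))^2 + 2 * ((wt l k)^s * cmod (fcoef l ?d k))^2)"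
    using wt_term_le_diff[of l _ s "fcoef l f _" "fcoef l g _"]
    by (intro infsum_mono Hs_summable[OF assms(1)] summable_on_add[OF s])
      (simp add: fcoef_diff[OF Hs_L2[OF assms(1)] Hs_L2[OF assms(2)]])
  also have "\<dots> = 2 * (\<Sum>\<^sub>\<infinity>k\<in>A. ((wt l k)^s * cmod (fcoef l g k))^2)
      + 2 * (\<Sum>\<^sub>\<infinity>k\<in>A. ((wt l k)^s * cmod (fcoef l ?d k))^2)"
    by (subst infsum_add[OF s]) (simp add: infsum_cmult_right')
  also have "(\<Sum>\<^sub>\<infinity>k\<in>A. ((wt l k)^s * cmod (fcoef l ?d k))^2) \<le> hsn l s ?d"
    unfolding hsn_eq by (intro infsum_mono2 Hs_summable Hs_diff assms) auto
  finally show ?thesis by simp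
qed

section \<open>Uniformity along curves on a compact time interval\<close>

lemma infsum_tail_le:
  fixes f :: "'a \<Rightarrow> real"
  assumes "f summable_on UNIV" "e > 0"
  obtains F where "finite F" "infsum f (UNIV - F) \<le> e"
proof -
  obtain F where F: "finite F" "dist (sum f F) (infsum f UNIV) \<le> e"
    using infsum_finite_approximation[OF assms] by blast
  have "infsum f (UNIV - F) = infsum f UNIV - infsum f F"
    by (rule infsum_Diff) (use assms F in auto)
  then have "infsum f (UNIV - F) \<le> e" using F by (simp add: dist_real_def)
  then show ?thesis using that F by blast
qed

text \<open>Heine-Borel for a relation: \<open>Q t t'\<close> stands for closeness of the states at
  the two times in a Sobolev norm, so finitely many centres represent the whole curve.\<close>

lemma compact_interval_cover:
  fixes a b :: real
  assumes "\<And>t. t \<in> {a..b} \<Longrightarrow> \<exists>d>0. \<forall>t'\<in>{a..b}. \<bar>t' - t\<bar> < d \<longrightarrow> Q t t'"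
  obtains D where "finite D" "D \<subseteq> {a..b}" "\<And>t'. t' \<in> {a..b} \<Longrightarrow> \<exists>t\<in>D. Q t t'"
proof -
  from assms obtain d where d: "\<And>t. t \<in> {a..b} \<Longrightarrow> d t > 0"
    "\<And>t t'. t \<in> {a..b} \<Longrightarrow> t' \<in> {a..b} \<Longrightarrow> \<bar>t' - t\<bar> < d t \<Longrightarrow> Q t t'"
    by metis
  have "{a..b} \<subseteq> (\<Union>t\<in>{a..b}. ball t (d t))" using d(1) by force
  then obtain D where D: "D \<subseteq> {a..b}" "finite D" "{a..b} \<subseteq> (\<Union>t\<in>D. ball t (d t))"
    using compactE_image[OF compact_Icc, of "{a..b}" "\<lambda>t. ball t (d t)"] by (metis open_ball)
  show ?thesis
  proof (rule that[OF D(2,1)])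
    fix t' assume t': "t' \<in> {a..b}"
    then obtain t where t: "t \<in> D" "t' \<in> ball t (d t)" using D(3) by blast
    then have "\<bar>t' - t\<bar> < d t" by (simp add: dist_real_def abs_minus_commute)
    then show "\<exists>t\<in>D. Q t t'" using t(1) D(1) d(2) t' by blast
  qed
qed

lemma cont_Hs_Hs: "cont_Hs l s a b u \<Longrightarrow> t \<in> {a..b} \<Longrightarrow> Hs l s (u t)"
  by (simp add: cont_Hs_def)

lemma cont_Hs_nbhd:
  assumes "cont_Hs l s a b u" "t \<in> {a..b}" "e > 0"
  shows "\<exists>d>0. \<forall>t'\<in>{a..b}. \<bar>t' - t\<bar> < d \<longrightarrow> hsn l s (\<lambda>x. u t' x - u t x) \<le> e"
proof -
  have "((\<lambda>t'. hsn l s (\<lambda>x. u t' x - u t x)) \<longlongrightarrow> 0) (at t within {a..b})"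
    using assms by (simp add: cont_Hs_def)
  from tendstoD[OF this assms(3)]
  obtain d where d: "d > 0" "\<And>t'. t' \<in> {a..b} \<Longrightarrow> t' \<noteq> t \<Longrightarrow> dist t' t < d \<Longrightarrow>
      dist (hsn l s (\<lambda>x. u t' x - u t x)) 0 < e"
    unfolding eventually_at by blast
  \<comment> \<open>The limit within the interval says nothing about \<open>t' = t\<close>, which is
    treated separately.\<close>
  have z: "hsn l s (\<lambda>x. u t x - u t x) = 0" by (simp add: hsn_def fcoef_def)
  show ?thesis
  proof (intro exI[of _ d] conjI ballI impI d(1))
    fix t' assume t': "t' \<in> {a..b}" "\<bar>t' - t\<bar> < d"
    show "hsn l s (\<lambda>x. u t' x - u t x) \<le> e"
    proof (cases "t' = t")
      case False
      then show ?thesis using d(2)[OF t'(1)] t'(2) by (simp add: dist_real_def)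
    qed (use z assms(3) in simp)
  qed
qed

lemma cont_Hs_bounded:
  assumes "cont_Hs l s a b u"
  obtains B where "\<And>t. t \<in> {a..b} \<Longrightarrow> hsn l s (u t) \<le> B"
proof -
  obtain D where D: "finite D" "D \<subseteq> {a..b}"
    "\<And>t'. t' \<in> {a..b} \<Longrightarrow> \<exists>t\<in>D. hsn l s (\<lambda>x. u t' x - u t x) \<le> 1"
    using compact_interval_cover[OF cont_Hs_nbhd[OF assms _ zero_less_one]] by blast
  define B where "B = (\<Sum>t\<in>D. 2 * hsn l s (u t)) + 2"
  show ?thesis
  proof (rule that[of B])
    fix t' assume t': "t' \<in> {a..b}"
    then obtain t where t: "t \<in> D" "hsn l s (\<lambda>x. u t' x - u t x) \<le> 1" using D(3) by blast
    have "hsn l s (u t') \<le> 2 * hsn l s (u t) + 2 * hsn l s (\<lambda>x. u t' x - u t x)"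
      using infsum_wt_le_diff[of l s "u t'" "u t" UNIV] cont_Hs_Hs[OF assms] t t' D(2)
      unfolding hsn_eq[symmetric] by blast
    also have "2 * hsn l s (u t) \<le> (\<Sum>t\<in>D. 2 * hsn l s (u t))"
      by (rule member_le_sum[OF t(1)]) (auto simp: hsn_nonneg D(1))
    finally show "hsn l s (u t') \<le> B" using t(2) by (simp add: B_def)
  qed
qed

text \<open>The image of the curve is compact, and compact sets in a Sobolev space have uniformly
  small tails. Both the tails at the centres and the distances are taken at most 1/4, since
  comparison doubles each.\<close>

lemma cont_Hs_uniform_tail:
  assumes "cont_Hs l s a b u"
  obtains F where "finite F"
    "\<And>t. t \<in> {a..b} \<Longrightarrow> (\<Sum>\<^sub>\<infinity>k\<in>UNIV - F. ((wt l k)^s * cmod (fcoef l (u t) k))^2) \<le> 1"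
proof -
  obtain D where D: "finite D" "D \<subseteq> {a..b}"
    "\<And>t'. t' \<in> {a..b} \<Longrightarrow> \<exists>t\<in>D. hsn l s (\<lambda>x. u t' x - u t x) \<le> 1/4"
    by (rule compact_interval_cover[OF cont_Hs_nbhd[OF assms, of _ "1/4"]]) auto
  have "\<exists>F. finite F \<and> (\<Sum>\<^sub>\<infinity>k\<in>UNIV - F. ((wt l k)^s * cmod (fcoef l (u t) k))^2) \<le> 1/4"
    if "t \<in> {a..b}" for t
    by (rule infsum_tail_le[OF Hs_summable[OF cont_Hs_Hs[OF assms that]], of "1/4"]) auto
  then obtain G where G: "\<And>t. t \<in> {a..b} \<Longrightarrow> finite (G t)"
    "\<And>t. t \<in> {a..b} \<Longrightarrow> (\<Sum>\<^sub>\<infinity>k\<in>UNIV - G t. ((wt l k)^s * cmod (fcoef l (u t) k))^2) \<le> 1/4"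
    by metis
  define F where "F = (\<Union>t\<in>D. G t)"
  show ?thesis
  proof (rule that[of F])
    show "finite F" using D G(1) by (auto simp: F_def)
    fix t' assume t': "t' \<in> {a..b}"
    then obtain t where t: "t \<in> D" "hsn l s (\<lambda>x. u t' x - u t x) \<le> 1/4" using D(3) by blast
    have tab: "t \<in> {a..b}" using t D by blast
    have "(\<Sum>\<^sub>\<infinity>k\<in>UNIV - F. ((wt l k)^s * cmod (fcoef l (u t) k))^2)
        \<le> (\<Sum>\<^sub>\<infinity>k\<in>UNIV - G t. ((wt l k)^s * cmod (fcoef l (u t) k))^2)"
      using t(1) by (intro infsum_mono2 Hs_summable[OF cont_Hs_Hs[OF assms tab]]) (auto simp: F_def)
    then show "(\<Sum>\<^sub>\<infinity>k\<in>UNIV - F. ((wt l k)^s * cmod (fcoef l (u t') k))^2) \<le> 1"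
      using infsum_wt_le_diff[OF cont_Hs_Hs[OF assms t'] cont_Hs_Hs[OF assms tab], of "UNIV - F"]
        G(2)[OF tab] t(2) by linarith
  qed
qed

lemma cont_Hs_mono:
  assumes "r \<le> s" "cont_Hs l s a b u"
  shows "cont_Hs l r a b u"
  unfolding cont_Hs_def
proof (intro conjI ballI)
  fix t assume t: "t \<in> {a..b}"
  show "Hs l r (u t)" by (rule Hs_mono[OF assms(1) cont_Hs_Hs[OF assms(2) t]])
  show "((\<lambda>t'. hsn l r (\<lambda>x. u t' x - u t x)) \<longlongrightarrow> 0) (at t within {a..b})"
  proof (rule tendsto_sandwich[OF _ _ tendsto_const])
    show "((\<lambda>t'. hsn l s (\<lambda>x. u t' x - u t x)) \<longlongrightarrow> 0) (at t within {a..b})"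
      using assms(2) t by (simp add: cont_Hs_def)
    show "\<forall>\<^sub>F t' in at t within {a..b}. hsn l r (\<lambda>x. u t' x - u t x) \<le> hsn l s (\<lambda>x. u t' x - u t x)"
      unfolding eventually_at
      by (intro exI[of _ 1] conjI ballI impI hsn_mono assms(1) Hs_diff cont_Hs_Hs[OF assms(2)] t) auto
  qed (auto simp: hsn_nonneg)
qed

text \<open>A single coefficient is dominated by the square root of \<open>hsn\<close> at level 0,
  so differentiability in that norm passes to every mode.\<close>

lemma fcoef_has_vector_derivative:
  assumes "deriv_L2 l a b u u'" "t \<in> {a..b}"
  shows "((\<lambda>t. fcoef l (u t) k) has_vector_derivative fcoef l (u' t) k) (at t within {a..b})"
proof -
  have H: "Hs l 0 (u s)" "Hs l 0 (u' s)" if "s \<in> {a..b}" for s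
    using assms(1) that by (auto simp: deriv_L2_def cont_Hs_def)
  let ?d = "\<lambda>s x. (u s x - u t x) / (s - t) - u' t x"
  have L: "((\<lambda>s. sqrt (hsn l 0 (?d s))) \<longlongrightarrow> 0) (at t within {a..b})"
    using assms tendsto_real_sqrt[of "\<lambda>s. hsn l 0 (?d s)" 0] by (simp add: deriv_L2_def)
  have "((\<lambda>s. norm ((fcoef l (u s) k - fcoef l (u t) k) /\<^sub>R (s - t) - fcoef l (u' t) k)) \<longlongrightarrow> 0)
      (at t within {a..b})"
  proof (rule tendsto_sandwich[OF _ _ tendsto_const L])
    show "\<forall>\<^sub>F s in at t within {a..b}.
      norm ((fcoef l (u s) k - fcoef l (u t) k) /\<^sub>R (s - t) - fcoef l (u' t) k) \<le> sqrt (hsn l 0 (?d s))"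
      unfolding eventually_at
    proof (intro exI[of _ 1] conjI ballI impI)
      fix s assume s: "s \<in> {a..b}" "s \<noteq> t \<and> dist s t < 1"
      note h = H[OF s(1)] H[OF assms(2)]
      have dq: "?d s = (\<lambda>x. (1 / (s - t)) * (u s x - u t x) - u' t x)" by simp
      have hd: "Hs l 0 (\<lambda>x. (1 / (s - t)) * (u s x - u t x))"
        by (rule Hs_cmult[OF Hs_diff[OF h(1,3)]])
      have "fcoef l (?d s) k = (fcoef l (u s) k - fcoef l (u t) k) /\<^sub>R (s - t) - fcoef l (u' t) k"
        unfolding dq
        by (subst fcoef_diff[OF Hs_L2[OF hd] Hs_L2[OF h(4)]], subst fcoef_cmult, subst fcoef_diff)
          (use h in \<open>auto simp: Hs_def scaleR_conv_of_real divide_inverse\<close>)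
      moreover have "(cmod (fcoef l (?d s) k))^2 \<le> hsn l 0 (?d s)"
        using coef_le_hsn[OF Hs_diff[OF hd h(4)], of k] unfolding dq by simp
      ultimately show "norm ((fcoef l (u s) k - fcoef l (u t) k) /\<^sub>R (s - t) - fcoef l (u' t) k)
          \<le> sqrt (hsn l 0 (?d s))"
        by (metis real_le_rsqrt)
    qed simp
  qed simp
  moreover have "norm ((1 / norm (s - t)) *\<^sub>R (fcoef l (u s) k - (fcoef l (u t) k + (s - t) *\<^sub>R fcoef l (u' t) k)))
      = norm ((fcoef l (u s) k - fcoef l (u t) k) /\<^sub>R (s - t) - fcoef l (u' t) k)" if "s \<noteq> t" for s
  proof -
    have "fcoef l (u s) k - (fcoef l (u t) k + (s - t) *\<^sub>R fcoef l (u' t) k)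
        = (s - t) *\<^sub>R ((fcoef l (u s) k - fcoef l (u t) k) /\<^sub>R (s - t) - fcoef l (u' t) k)"
      using that by (simp add: scaleR_diff_right)
    then show ?thesis using that by simp
  qed
  then have "\<forall>\<^sub>F s in at t within {a..b}.
      norm ((fcoef l (u s) k - fcoef l (u t) k) /\<^sub>R (s - t) - fcoef l (u' t) k)
      = norm ((1 / norm (s - t)) *\<^sub>R (fcoef l (u s) k - (fcoef l (u t) k + (s - t) *\<^sub>R fcoef l (u' t) k)))"
    unfolding eventually_at by (intro exI[of _ 1]) simp
  ultimately have "((\<lambda>s. norm ((1 / norm (s - t)) *\<^sub>R
      (fcoef l (u s) k - (fcoef l (u t) k + (s - t) *\<^sub>R fcoef l (u' t) k)))) \<longlongrightarrow> 0) (at t within {a..b})"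
    by (rule Lim_transform_eventually)
  then show ?thesis
    unfolding has_vector_derivative_def has_derivative_within
    by (intro conjI bounded_linear_scaleR_left) (rule tendsto_norm_zero_cancel)
qed

subsection \<open>Product estimates\<close>

definition wt_sum :: "real \<Rightarrow> real" where
  "wt_sum l = (\<Sum>\<^sub>\<infinity>k. 1 / (wt l k)^2)"

lemma wt_sum_nonneg: "wt_sum l \<ge> 0"
  unfolding wt_sum_def by (rule infsum_nonneg) simp

lemma mult_le_half_squares: "x * y \<le> (x^2 + y^2) / (2 :: real)"
  using sum_squares_bound[of x y] by simp

text \<open>Sobolev embedding on the coefficient side: one derivative buys summability, by Young's
  inequality on \<open>(1 / wt) * (c * wt * a)\<close>. The scalar \<open>c\<close> stays inside so
  that a small factor enters squared, matching what the energy controls.\<close>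

lemma coef_weighted_l1:
  assumes l: "l > 0" and f: "Hs l (Suc s) f" and c: "c \<ge> 0"
  shows "(\<lambda>k. c * ((wt l k)^s * cmod (fcoef l f k))) summable_on UNIV"
    "(\<Sum>\<^sub>\<infinity>k. c * ((wt l k)^s * cmod (fcoef l f k))) \<le> (wt_sum l + c^2 * hsn l (Suc s) f) / 2"
proof -
  let ?a = "\<lambda>k. (wt l k)^s * cmod (fcoef l f k)"
  let ?b = "\<lambda>k. (wt l k)^(Suc s) * cmod (fcoef l f k)"
  let ?m = "\<lambda>k. (1/2) * (1 / (wt l k)^2) + (1/2) * (c^2 * (?b k)^2)"
  have s1: "(\<lambda>k. (1/2) * (1 / (wt l k)^2)) summable_on UNIV"
    by (intro summable_on_cmult_right summable_inverse_wt l)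
  have s2: "(\<lambda>k. (1/2) * (c^2 * (?b k)^2)) summable_on UNIV"
    by (intro summable_on_cmult_right Hs_summable f)
  have le: "c * ?a k \<le> ?m k" for k
  proof -
    have w: "wt l k > 0" using wt_ge_1[of l k] by simp
    have "c * ?a k = (1 / wt l k) * (c * ?b k)" using w by simp
    also have "\<dots> \<le> ((1 / wt l k)^2 + (c * ?b k)^2) / 2"
      by (rule mult_le_half_squares)
    also have "\<dots> = ?m k" by (simp only: power_mult_distrib power_divide power_one) simp
    finally show ?thesis .
  qed
  show s: "(\<lambda>k. c * ?a k) summable_on UNIV"
    by (rule summable_on_comparison_test[OF summable_on_add[OF s1 s2] le]) (use c in simp)
  have "(\<Sum>\<^sub>\<infinity>k. c * ?a k) \<le> infsum ?m UNIV"
    by (rule infsum_mono[OF s summable_on_add[OF s1 s2] le])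
  also have "\<dots> = (1/2) * wt_sum l + (1/2) * (c^2 * hsn l (Suc s) f)"
    unfolding infsum_add[OF s1 s2] infsum_cmult_right' wt_sum_def hsn_eq ..
  finally show "(\<Sum>\<^sub>\<infinity>k. c * ?a k) \<le> (wt_sum l + c^2 * hsn l (Suc s) f) / 2" by simp
qed

lemma coef_l1:
  assumes "l > 0" "Hs l 1 f"
  shows "(\<lambda>k. cmod (fcoef l f k)) summable_on UNIV"
  using coef_weighted_l1(1)[of l 0 f 1] assms by simp

lemma norm_fcoef_mult_le:
  assumes l: "l > 0" and f: "Hs l 1 f" and g: "Hs l 0 g"
  shows "(\<lambda>j. cmod (fcoef l f (k - j)) * cmod (fcoef l g j)) summable_on UNIV"
    "cmod (fcoef l (\<lambda>x. f x * g x) k) \<le> (\<Sum>\<^sub>\<infinity>j. cmod (fcoef l f (k - j)) * cmod (fcoef l g j))"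
proof -
  have g2: "(\<lambda>k. (cmod (fcoef l g k))^2) summable_on UNIV" using Hs_summable[OF g, of UNIV] by simp
  show s: "(\<lambda>j. cmod (fcoef l f (k - j)) * cmod (fcoef l g j)) summable_on UNIV"
    by (rule convolution_summable(2)[OF coef_l1[OF l f] _ g2]) auto
  have b: "bij_betw (\<lambda>j. k - j) UNIV (UNIV :: int set)"
    by (rule bij_betwI[of _ _ _ "\<lambda>j. k - j"]) auto
  have "((\<lambda>j. fcoef l f j * fcoef l g (k - j)) has_sum fcoef l (\<lambda>x. f x * g x) k) UNIV"
    by (rule fcoef_mult_has_sum[OF l Hs_L2[OF f] Hs_L2[OF g] coef_l1[OF l f]])
  then have "((\<lambda>j. fcoef l f (k - j) * fcoef l g j) has_sum fcoef l (\<lambda>x. f x * g x) k) UNIV"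
    using has_sum_reindex_bij_betw[OF b, of "\<lambda>j. fcoef l f j * fcoef l g (k - j)"] by simp
  then have "fcoef l (\<lambda>x. f x * g x) k = (\<Sum>\<^sub>\<infinity>j. fcoef l f (k - j) * fcoef l g j)"
    by (simp add: infsumI)
  also have "cmod \<dots> \<le> (\<Sum>\<^sub>\<infinity>j. cmod (fcoef l f (k - j) * fcoef l g j))"
    by (rule norm_infsum_bound) (use s in \<open>simp add: norm_mult\<close>)
  finally show "cmod (fcoef l (\<lambda>x. f x * g x) k) \<le> (\<Sum>\<^sub>\<infinity>j. cmod (fcoef l f (k - j)) * cmod (fcoef l g j))"
    by (simp add: norm_mult)
qed

text \<open>The weight is distributed multiplicatively. The extra derivative of \<open>f\<close>
  makes the kernel summable, ready for Schur's test.\<close>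

lemma weighted_product_le:
  assumes l: "l > 0" and f: "Hs l (Suc r) f" and g: "Hs l r g"
  shows "(\<lambda>j. (2^r * ((wt l (k - j))^r * cmod (fcoef l f (k - j)))) * ((wt l j)^r * cmod (fcoef l g j))) summable_on UNIV"
    "(wt l k)^r * cmod (fcoef l (\<lambda>x. f x * g x) k)
      \<le> (\<Sum>\<^sub>\<infinity>j. (2^r * ((wt l (k - j))^r * cmod (fcoef l f (k - j)))) * ((wt l j)^r * cmod (fcoef l g j)))"
proof -
  have f1: "Hs l 1 f" and g0: "Hs l 0 g" by (rule Hs_mono[OF _ f], simp) (rule Hs_mono[OF _ g], simp)
  note c = norm_fcoef_mult_le[OF l f1 g0, of k]
  show s: "(\<lambda>j. (2^r * ((wt l (k - j))^r * cmod (fcoef l f (k - j)))) * ((wt l j)^r * cmod (fcoef l g j))) summable_on UNIV"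
    by (rule convolution_summable(2)[OF coef_weighted_l1(1)[OF l f] _ Hs_summable[OF g]]) auto
  have "(wt l k)^r * cmod (fcoef l (\<lambda>x. f x * g x) k)
      \<le> (wt l k)^r * (\<Sum>\<^sub>\<infinity>j. cmod (fcoef l f (k - j)) * cmod (fcoef l g j))"
    by (intro mult_left_mono c(2)) simp
  also have "\<dots> = (\<Sum>\<^sub>\<infinity>j. (wt l k)^r * (cmod (fcoef l f (k - j)) * cmod (fcoef l g j)))"
    by (simp add: infsum_cmult_right')
  also have "\<dots> \<le> (\<Sum>\<^sub>\<infinity>j. (2^r * ((wt l (k - j))^r * cmod (fcoef l f (k - j)))) * ((wt l j)^r * cmod (fcoef l g j)))"
  proof (intro infsum_mono s summable_on_cmult_right c(1))
    fix j
    show "(wt l k)^r * (cmod (fcoef l f (k - j)) * cmod (fcoef l g j))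
        \<le> (2^r * ((wt l (k - j))^r * cmod (fcoef l f (k - j)))) * ((wt l j)^r * cmod (fcoef l g j))"
      using mult_right_mono[OF wt_power_add_le_mult[of l "k - j" j r],
          of "cmod (fcoef l f (k - j)) * cmod (fcoef l g j)"]
      by (simp add: mult_ac)
  qed
  finally show "(wt l k)^r * cmod (fcoef l (\<lambda>x. f x * g x) k)
      \<le> (\<Sum>\<^sub>\<infinity>j. (2^r * ((wt l (k - j))^r * cmod (fcoef l f (k - j)))) * ((wt l j)^r * cmod (fcoef l g j)))" .
qed

text \<open>Tame estimate: all derivatives fall on one factor, and the other one enters only through
  its \<open>\<ell>\<^sup>1\<close> norm of coefficients.\<close>

lemma weighted_square_le:
  assumes l: "l > 0" and f: "Hs l 1 f" "Hs l r f"
  shows "(\<lambda>j. (2^(Suc r) * cmod (fcoef l f (k - j))) * ((wt l j)^r * cmod (fcoef l f j))) summable_on UNIV"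
    "(wt l k)^r * cmod (fcoef l (\<lambda>x. (f x)^2) k)
      \<le> (\<Sum>\<^sub>\<infinity>j. (2^(Suc r) * cmod (fcoef l f (k - j))) * ((wt l j)^r * cmod (fcoef l f j)))"
proof -
  let ?a = "\<lambda>j. cmod (fcoef l f j)"
  have f0: "Hs l 0 f" by (rule Hs_mono[OF _ f(1)]) simp
  note c = norm_fcoef_mult_le[OF l f(1) f0, of k]
  \<comment> \<open>The two cases of the additive weight bound are mirror images under
    \<open>j \<mapsto> k - j\<close>, so one kernel serves twice; this is the source of the exponent
    \<open>Suc r\<close>.\<close>
  let ?u = "\<lambda>j. 2^r * (?a (k - j) * ((wt l j)^r * ?a j))"
  have s1: "?u summable_on UNIV"
    by (intro summable_on_cmult_right convolution_summable(2) coef_l1[OF l f(1)] Hs_summable f) auto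
  have s2: "(\<lambda>j. ?u (k - j)) summable_on UNIV" by (rule summable_on_shift(1)[OF s1])
  show "(\<lambda>j. (2^(Suc r) * ?a (k - j)) * ((wt l j)^r * ?a j)) summable_on UNIV"
    using summable_on_cmult_right[OF s1, of 2] by (simp add: mult.assoc)
  have "(wt l k)^r * cmod (fcoef l (\<lambda>x. f x * f x) k) \<le> (wt l k)^r * (\<Sum>\<^sub>\<infinity>j. ?a (k - j) * ?a j)"
    by (intro mult_left_mono c(2)) simp
  also have "\<dots> = (\<Sum>\<^sub>\<infinity>j. (wt l k)^r * (?a (k - j) * ?a j))"
    by (simp add: infsum_cmult_right')
  also have "\<dots> \<le> (\<Sum>\<^sub>\<infinity>j. ?u j + ?u (k - j))"
  proof (intro infsum_mono summable_on_add s1 s2 summable_on_cmult_right c(1))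
    fix j
    show "(wt l k)^r * (?a (k - j) * ?a j) \<le> ?u j + ?u (k - j)"
      using mult_right_mono[OF wt_power_add_le[of l "k - j" j r], of "?a (k - j) * ?a j"]
      by (simp add: algebra_simps)
  qed
  also have "\<dots> = infsum ?u UNIV + (\<Sum>\<^sub>\<infinity>j. ?u (k - j))" by (rule infsum_add[OF s1 s2])
  also have "(\<Sum>\<^sub>\<infinity>j. ?u (k - j)) = infsum ?u UNIV" by (rule summable_on_shift(2)[OF s1])
  also have "infsum ?u UNIV + infsum ?u UNIV = (\<Sum>\<^sub>\<infinity>j. 2 * ?u j)"
    by (subst infsum_cmult_right') (rule mult_2[symmetric])
  finally show "(wt l k)^r * cmod (fcoef l (\<lambda>x. (f x)^2) k)
      \<le> (\<Sum>\<^sub>\<infinity>j. (2^(Suc r) * ?a (k - j)) * ((wt l j)^r * ?a j))"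
    by (simp add: power2_eq_square mult.assoc)
qed

text \<open>The convolution formula for \<open>g * g\<close> at frequency 0; for real
  \<open>g\<close> the coefficients at \<open>k\<close> and \<open>-k\<close> are conjugate.\<close>

lemma parseval:
  assumes l: "l > 0" and g: "L2 l g" and s: "(\<lambda>k. cmod (fcoef l g k)) summable_on UNIV"
  shows "((\<lambda>k. (cmod (fcoef l g k))^2) has_sum integral (cell l) (\<lambda>x. (g x)^2) / l) UNIV"
proof -
  have "((\<lambda>k. fcoef l g k * fcoef l g (0 - k)) has_sum fcoef l (\<lambda>x. g x * g x) 0) UNIV"
    by (rule fcoef_mult_has_sum[OF l g g s])
  moreover have "fcoef l g k * fcoef l g (0 - k) = complex_of_real ((cmod (fcoef l g k))^2)" for k
    by (simp only: diff_0 fcoef_minus complex_norm_square)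
  moreover have "fcoef l (\<lambda>x. g x * g x) 0 = complex_of_real (integral (cell l) (\<lambda>x. (g x)^2) / l)"
  proof -
    have "(\<lambda>x. (g x)^2) integrable_on cell l" using g by (simp add: L2_def)
    then have "integral (cell l) (\<lambda>x. complex_of_real ((g x)^2)) = complex_of_real (integral (cell l) (\<lambda>x. (g x)^2))"
      by (intro integral_unique has_integral_of_real integrable_integral)
    then show ?thesis by (simp add: fcoef_def power2_eq_square)
  qed
  ultimately show ?thesis by (simp add: has_sum_of_real_iff del: of_real_power of_real_divide)
qed

text \<open>The derivative beyond order \<open>m\<close> makes the coefficients of \<open>g\<close>
  summable, so that Parseval applies.\<close>

lemma integral_wder_le:
  assumes l: "l > 0" and f: "Hs l (Suc m) f" and g: "wder l m f g"
  shows "integral (cell l) (\<lambda>x. (g x)^2) \<le> l * hsn l m f"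
proof -
  have L: "L2 l g" and c: "\<And>k. cmod (fcoef l g k) \<le> (wt l k)^m * cmod (fcoef l f k)"
  proof -
    show "L2 l g" using g by (simp add: wder_def)
    fix k
    have "cmod (dsym l k) \<le> wt l k" by (simp add: cmod_dsym wt_def)
    then have "cmod (dsym l k) ^ m * cmod (fcoef l f k) \<le> (wt l k)^m * cmod (fcoef l f k)"
      by (intro mult_right_mono power_mono) auto
    then show "cmod (fcoef l g k) \<le> (wt l k)^m * cmod (fcoef l f k)"
      using g by (simp add: wder_def norm_mult norm_power)
  qed
  have s: "(\<lambda>k. cmod (fcoef l g k)) summable_on UNIV"
    using coef_weighted_l1(1)[OF l f, of 1] c by (intro summable_on_comparison_test[of _ _ "\<lambda>k. cmod (fcoef l g k)"]) auto
  have "integral (cell l) (\<lambda>x. (g x)^2) / l = (\<Sum>\<^sub>\<infinity>k. (cmod (fcoef l g k))^2)"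
    using parseval[OF l L s] by (simp add: infsumI)
  also have "\<dots> \<le> hsn l m f"
    unfolding hsn_eq using parseval[OF l L s] c
    by (intro infsum_mono Hs_summable[OF Hs_mono[OF _ f]] power_mono) (auto simp: summable_on_def)
  finally show ?thesis using l by (simp add: field_simps)
qed

subsection \<open>The energy estimate\<close>

text \<open>The differential inequality is available only below \<open>M\<close>. Up to the first
  time at which \<open>M\<close> is reached it holds throughout, and Gronwall then gives a value
  strictly less than \<open>M\<close>, a contradiction.\<close>

lemma gronwall_bootstrap:
  fixes y y' :: "real \<Rightarrow> real"
  assumes deriv: "\<And>t. t \<in> {0..T1} \<Longrightarrow> (y has_real_derivative y' t) (at t within {0..T1})"
    and y0: "y 0 = 0" and c: "c > 0" "c' \<ge> 0" and T: "T1 \<le> T"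
    and ineq: "\<And>t. t \<in> {0..T1} \<Longrightarrow> y t \<le> M \<Longrightarrow> y' t \<le> c * y t + c'"
    and M: "c' / c * (exp (c * T) - 1) < M" and t1: "t1 \<in> {0..T1}"
  shows "y t1 \<le> M"
proof (rule ccontr)
  assume "\<not> y t1 \<le> M"
  then have big: "y t1 > M" by simp
  have T0: "0 \<le> T" using t1 T by auto
  have "c' / c * (exp (c * T) - 1) \<ge> 0" using c T0 by (intro mult_nonneg_nonneg) auto
  then have M0: "M > 0" using M by simp
  have cont: "continuous_on {0..T1} y"
    using deriv by (intro DERIV_continuous_on) auto
  define S where "S = {t \<in> {0..t1}. M \<le> y t}"
  have "closed S" unfolding S_def
    by (rule continuous_on_closed_Collect_le[OF continuous_on_const continuous_on_subset[OF cont]])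
      (use t1 in auto)
  moreover have "S \<noteq> {}" using big t1 by (auto simp: S_def)
  moreover have "bdd_below S" by (auto simp: S_def)
  ultimately have "Inf S \<in> S" by (intro closed_contains_Inf)
  define ts where "ts = Inf S"
  have ts: "ts \<in> {0..t1}" "M \<le> y ts" using \<open>Inf S \<in> S\<close> by (auto simp: S_def ts_def)
  have below: "y t < M" if "0 \<le> t" "t < ts" for t
  proof (rule ccontr)
    assume "\<not> y t < M"
    then have "t \<in> S" using that ts by (auto simp: S_def)
    then have "ts \<le> t" unfolding ts_def by (intro cInf_lower \<open>bdd_below S\<close>)
    then show False using that by simp
  qed
  have "ts \<noteq> 0" using ts y0 M0 by auto
  \<comment> \<open>With this integrating factor \<open>v\<close> is nonincreasing up to the first
    contact, starting from \<open>c' / c\<close>.\<close>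
  define v where "v t = (y t + c' / c) * exp (- c * t)" for t
  have "v ts \<le> v 0"
  proof (rule DERIV_nonpos_imp_decreasing_open[of 0 ts v])
    show "0 \<le> ts" using ts by simp
    show "continuous_on {0..ts} v"
      unfolding v_def using ts t1 by (intro continuous_intros continuous_on_subset[OF cont]) auto
    fix t assume t: "0 < t" "t < ts"
    then have tT: "t \<in> {0..T1}" "t < T1" using ts t1 by auto
    have "(y has_real_derivative y' t) (at t)"
      using deriv[OF tT(1)] t tT by (simp add: at_within_Icc_at)
    then have "(v has_real_derivative (y' t - c * y t - c') * exp (- c * t)) (at t)"
      unfolding v_def using c by (auto intro!: derivative_eq_intros simp: field_simps)
    moreover have "(y' t - c * y t - c') * exp (- c * t) \<le> 0"
      using ineq[OF tT(1)] below[of t] t by (intro mult_nonpos_nonneg) auto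
    ultimately show "\<exists>d. (v has_real_derivative d) (at t) \<and> d \<le> 0" by blast
  qed
  then have "(y ts + c' / c) * exp (- c * ts) \<le> c' / c" by (simp add: v_def y0)
  then have "(y ts + c' / c) * exp (- c * ts) * exp (c * ts) \<le> c' / c * exp (c * ts)"
    by (rule mult_right_mono) simp
  moreover have "exp (- c * ts) * exp (c * ts) = 1" by (simp add: exp_add[symmetric])
  ultimately have "y ts + c' / c \<le> c' / c * exp (c * ts)" by (simp only: mult.assoc mult_1_right)
  also have "\<dots> \<le> c' / c * exp (c * T)"
    using c ts t1 T by (intro mult_left_mono) auto
  finally have "y ts \<le> c' / c * (exp (c * T) - 1)" by (simp add: algebra_simps)
  then show False using ts M by simp
qed

text \<open>The kernel is fixed by \<open>s\<close> while \<open>r\<close> varies below it, so the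
  same l1 bound works at levels n and n+2. The square of \<open>z\<close> uses the tame estimate,
  hence only the unweighted coefficients of \<open>e * z\<close> enter.\<close>

lemma quadratic_coef_le:
  assumes l: "l > 0" and e: "e > 0" and r: "r \<le> s"
    and z: "Hs l (Suc 0) z" "Hs l r z" and \<psi>: "Hs l (Suc s) \<psi>"
  defines "p \<equiv> \<lambda>k. 2^(Suc s) * (e * cmod (fcoef l z k) + (wt l k)^s * cmod (fcoef l \<psi> k))"
  shows "(wt l k)^r * cmod (complex_of_real e * fcoef l (\<lambda>x. (z x)^2) k + 2 * fcoef l (\<lambda>x. \<psi> x * z x) k)
    \<le> (\<Sum>\<^sub>\<infinity>j. p (k - j) * ((wt l j)^r * cmod (fcoef l z j)))"
proof -
  have \<psi>r: "Hs l (Suc r) \<psi>" by (rule Hs_mono[OF _ \<psi>]) (use r in simp)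
  have z1: "Hs l 1 z" using z by simp
  let ?u = "\<lambda>j. (2^(Suc r) * cmod (fcoef l z (k - j))) * ((wt l j)^r * cmod (fcoef l z j))"
  let ?v = "\<lambda>j. (2^r * ((wt l (k - j))^r * cmod (fcoef l \<psi> (k - j)))) * ((wt l j)^r * cmod (fcoef l z j))"
  note u = weighted_square_le[OF l z1 z(2), of k]
  note v = weighted_product_le[OF l \<psi>r z(2), of k]
  have s1: "(\<lambda>j. e * ?u j) summable_on UNIV" and s2: "(\<lambda>j. 2 * ?v j) summable_on UNIV"
    by (intro summable_on_cmult_right u v)+
  have ps: "p summable_on UNIV"
    unfolding p_def using coef_l1[OF l z1] coef_weighted_l1(1)[OF l \<psi>, of 1]
    by (intro summable_on_cmult_right summable_on_add) auto
  have "cmod (complex_of_real e * fcoef l (\<lambda>x. (z x)^2) k + 2 * fcoef l (\<lambda>x. \<psi> x * z x) k)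
      \<le> e * cmod (fcoef l (\<lambda>x. (z x)^2) k) + 2 * cmod (fcoef l (\<lambda>x. \<psi> x * z x) k)"
    by (rule order_trans[OF norm_triangle_ineq]) (use e in \<open>simp add: norm_mult\<close>)
  then have "(wt l k)^r * cmod (complex_of_real e * fcoef l (\<lambda>x. (z x)^2) k + 2 * fcoef l (\<lambda>x. \<psi> x * z x) k)
      \<le> (wt l k)^r * (e * cmod (fcoef l (\<lambda>x. (z x)^2) k) + 2 * cmod (fcoef l (\<lambda>x. \<psi> x * z x) k))"
    by (rule mult_left_mono) simp
  also have "\<dots> = e * ((wt l k)^r * cmod (fcoef l (\<lambda>x. (z x)^2) k))
      + 2 * ((wt l k)^r * cmod (fcoef l (\<lambda>x. \<psi> x * z x) k))"
    by (simp add: algebra_simps)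
  also have "\<dots> \<le> e * infsum ?u UNIV + 2 * infsum ?v UNIV"
    using e by (intro add_mono mult_left_mono u(2) v(2)) auto
  also have "\<dots> = (\<Sum>\<^sub>\<infinity>j. e * ?u j + 2 * ?v j)"
    by (subst infsum_add[OF s1 s2]) (simp only: infsum_cmult_right')
  also have "\<dots> \<le> (\<Sum>\<^sub>\<infinity>j. p (k - j) * ((wt l j)^r * cmod (fcoef l z j)))"
  proof (rule infsum_mono[OF summable_on_add[OF s1 s2]])
    show "(\<lambda>j. p (k - j) * ((wt l j)^r * cmod (fcoef l z j))) summable_on UNIV"
      by (rule convolution_summable(2)[OF ps _ Hs_summable[OF z(2)]]) (use e in \<open>auto simp: p_def\<close>)
    fix j
    let ?i = "k - j"
    have "2^(Suc r) * (e * cmod (fcoef l z ?i)) \<le> 2^(Suc s) * (e * cmod (fcoef l z ?i))"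
      using e r by (intro mult_right_mono power_increasing) auto
    moreover have "2^(Suc r) * ((wt l ?i)^r * cmod (fcoef l \<psi> ?i)) \<le> 2^(Suc s) * ((wt l ?i)^s * cmod (fcoef l \<psi> ?i))"
      using r by (intro mult_mono power_increasing wt_power_mono) auto
    ultimately have "2^(Suc r) * (e * cmod (fcoef l z ?i)) + 2^(Suc r) * ((wt l ?i)^r * cmod (fcoef l \<psi> ?i)) \<le> p ?i"
      unfolding p_def distrib_left by (rule add_mono)
    then have "(2^(Suc r) * (e * cmod (fcoef l z ?i)) + 2^(Suc r) * ((wt l ?i)^r * cmod (fcoef l \<psi> ?i)))
        * ((wt l j)^r * cmod (fcoef l z j)) \<le> p ?i * ((wt l j)^r * cmod (fcoef l z j))"
      by (rule mult_right_mono) simp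
    then show "e * ?u j + 2 * ?v j \<le> p ?i * ((wt l j)^r * cmod (fcoef l z j))"
      by (simp add: algebra_simps)
  qed
  finally show ?thesis .
qed

lemma hsn_split:
  assumes "finite F" "Hs l s f"
  shows "hsn l s f = (\<Sum>k\<in>F. ((wt l k)^s * cmod (fcoef l f k))^2)
    + (\<Sum>\<^sub>\<infinity>k\<in>UNIV - F. ((wt l k)^s * cmod (fcoef l f k))^2)"
  unfolding hsn_eq using infsum_Diff[OF Hs_summable[OF assms(2)] summable_on_finite[OF assms(1)] subset_UNIV]
    assms(1) by simp

lemma hsn_le_finite_part:
  assumes "finite F" "Hs l s f" "r \<le> s"
    and "(\<Sum>\<^sub>\<infinity>k\<in>UNIV - F. ((wt l k)^s * cmod (fcoef l f k))^2) \<le> 1"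
  shows "hsn l r f \<le> (\<Sum>k\<in>F. ((wt l k)^r * cmod (fcoef l f k))^2) + 1"
proof -
  have r: "Hs l r f" by (rule Hs_mono[OF assms(3,2)])
  have "(\<Sum>\<^sub>\<infinity>k\<in>UNIV - F. ((wt l k)^r * cmod (fcoef l f k))^2)
      \<le> (\<Sum>\<^sub>\<infinity>k\<in>UNIV - F. ((wt l k)^s * cmod (fcoef l f k))^2)"
    by (intro infsum_mono Hs_summable r assms wt_term_mono)
  then show ?thesis using hsn_split[OF assms(1) r] assms(4) by simp
qed

text \<open>The mode equation is paired with the coefficient of the solution. The total weight of
  each error term is split so that the solution takes n+2 powers, the amount the dissipation
  controls; the first-order part of \<open>f\<close> has only 2n+1 to share.\<close>

lemma mode_energy_rate_le:
  fixes z z' h P q :: complex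
  assumes e: "e > 0" "e \<le> 1"
    and eq: "complex_of_real (bsym l e k) * z' + complex_of_real (hsym l e k) * h
      = complex_of_real (ssym l k) * z + complex_of_real (msym l e k) * dsym l k * P
        + complex_of_real (fsym l e k) * dsym l k * q"
  defines "w \<equiv> wt l k"
  shows "2 * (w^(2 * n) * bsym l e k * (z \<bullet> z'))
    \<le> 12 * (w^n * cmod z)^2 - 4 * (w^(n+2) * cmod z)^2
      + 24 * ((w^(n+2) * cmod z) * (w^n * cmod h))
      + 78 * ((w^(n+2) * cmod z) * (w^(n+2) * cmod P))
      + 2 * ((w^(n+1) * cmod z) * (w^n * cmod q))
      + 78 * e * ((w^(n+2) * cmod z) * (w^(n+2) * cmod q))"
proof -
  have sc: "z \<bullet> (complex_of_real c * v) = c * (z \<bullet> v)" for c v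
    by (metis inner_scaleR_right scaleR_conv_of_real)
  have cs: "z \<bullet> v \<le> cmod z * B" if "cmod v \<le> B" for v B
    using norm_cauchy_schwarz[of z v] mult_left_mono[OF that, of "cmod z"] by simp
  have "bsym l e k * (z \<bullet> z') = z \<bullet> (complex_of_real (bsym l e k) * z')" by (simp only: sc)
  also have "complex_of_real (bsym l e k) * z' = complex_of_real (ssym l k) * z
      + complex_of_real (msym l e k) * dsym l k * P + complex_of_real (fsym l e k) * dsym l k * q
      - complex_of_real (hsym l e k) * h"
    using eq by (simp add: algebra_simps)
  also have "z \<bullet> \<dots> = ssym l k * (cmod z)^2 + z \<bullet> (complex_of_real (msym l e k) * dsym l k * P)
      + z \<bullet> (complex_of_real (fsym l e k) * dsym l k * q) + z \<bullet> (- complex_of_real (hsym l e k) * h)"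
    by (simp add: inner_add_right inner_diff_right sc power2_norm_eq_inner del: minus_mult_left)
  also have "\<dots> \<le> (6 - 2 * w^4) * (cmod z)^2 + cmod z * (39 * w^4 * cmod P)
      + cmod z * ((w + 39 * e * w^4) * cmod q) + cmod z * (12 * w^2 * cmod h)"
  proof (intro add_mono cs mult_right_mono)
    show "ssym l k \<le> 6 - 2 * w^4" unfolding w_def by (rule ssym_le)
    show "cmod (complex_of_real (msym l e k) * dsym l k * P) \<le> 39 * w^4 * cmod P"
      using mult_right_mono[OF msym_bound[OF e, of l k], of "cmod P"]
      by (simp add: norm_mult cmod_dsym w_def)
    show "cmod (complex_of_real (fsym l e k) * dsym l k * q) \<le> (w + 39 * e * w^4) * cmod q"
      using mult_right_mono[OF fsym_bound[OF e, of l k], of "cmod q"]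
      by (simp add: norm_mult cmod_dsym w_def)
    show "cmod (- complex_of_real (hsym l e k) * h) \<le> 12 * w^2 * cmod h"
      using mult_right_mono[OF hsym_bound[OF e, of l k], of "cmod h"]
      by (simp add: norm_mult w_def)
  qed simp
  finally have "2 * w^(2 * n) * (bsym l e k * (z \<bullet> z')) \<le> 2 * w^(2 * n) * ((6 - 2 * w^4) * (cmod z)^2
      + cmod z * (39 * w^4 * cmod P) + cmod z * ((w + 39 * e * w^4) * cmod q) + cmod z * (12 * w^2 * cmod h))"
    by (intro mult_left_mono) (auto simp: w_def)
  also have "\<dots> = 12 * (w^n * cmod z)^2 - 4 * (w^(n+2) * cmod z)^2
      + 24 * ((w^(n+2) * cmod z) * (w^n * cmod h))
      + 78 * ((w^(n+2) * cmod z) * (w^(n+2) * cmod P))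
      + 2 * ((w^(n+1) * cmod z) * (w^n * cmod q))
      + 78 * e * ((w^(n+2) * cmod z) * (w^(n+2) * cmod q))"
  proof -
    have w2n: "w^(2 * n) = w^n * w^n" by (simp add: power_add[symmetric] mult_2)
    have w4: "w^4 = w * w * w * w" by (simp add: power4_eq_xxxx)
    show ?thesis
      unfolding w2n power_add w4 power2_eq_square power_one_right by (simp add: algebra_simps)
  qed
  finally show ?thesis by (simp add: mult.assoc)
qed

text \<open>The summand 1 stands for the discarded modes: their tail at level n+2 dominates those at
  levels n and n+1, and \<open>e \<le> 1\<close>.\<close>

lemma energy_bounds:
  assumes e: "e > 0" "e \<le> 1" and F: "finite F" and z: "Hs l (n+2) z"
    and tail: "(\<Sum>\<^sub>\<infinity>k\<in>UNIV - F. ((wt l k)^(n+2) * cmod (fcoef l z k))^2) \<le> 1"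
    and E: "E = (\<Sum>k\<in>F. (wt l k)^(2 * n) * bsym l e k * (cmod (fcoef l z k))^2)"
  shows "(\<Sum>k\<in>F. ((wt l k)^n * cmod (fcoef l z k))^2) \<le> E"
    "hsn l n z \<le> E + 1" "e * hsn l (n+1) z \<le> E + 1"
proof -
  have 1: "((wt l k)^n * cmod (fcoef l z k))^2 = (wt l k)^(2*n) * 1 * (cmod (fcoef l z k))^2" for k
    by (simp add: power_mult_distrib power_mult[symmetric] mult.commute)
  show An: "(\<Sum>k\<in>F. ((wt l k)^n * cmod (fcoef l z k))^2) \<le> E" unfolding E 1
    by (intro sum_mono mult_right_mono mult_left_mono bsym_ge e) auto
  have 2: "e * ((wt l k)^(n+1) * cmod (fcoef l z k))^2
      = (wt l k)^(2*n) * (e * (wt l k)^2) * (cmod (fcoef l z k))^2" for k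
  proof -
    have "((wt l k)^(n+1))^2 = (wt l k)^(2*n) * (wt l k)^2"
      using power_mult[of "wt l k" "n + 1" 2] power_add[of "wt l k" "2 * n" 2] by (simp add: mult.commute)
    then show ?thesis by (simp only: power_mult_distrib mult_ac)
  qed
  have An1: "e * (\<Sum>k\<in>F. ((wt l k)^(n+1) * cmod (fcoef l z k))^2) \<le> E"
    unfolding E sum_distrib_left 2
    by (intro sum_mono mult_right_mono mult_left_mono bsym_ge e) auto
  show "hsn l n z \<le> E + 1"
    using hsn_le_finite_part[OF F z _ tail, of n] An by simp
  have "e * hsn l (n+1) z \<le> e * ((\<Sum>k\<in>F. ((wt l k)^(n+1) * cmod (fcoef l z k))^2) + 1)"
    using e by (intro mult_left_mono hsn_le_finite_part[OF F z _ tail]) auto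
  also have "\<dots> = e * (\<Sum>k\<in>F. ((wt l k)^(n+1) * cmod (fcoef l z k))^2) + e" by (simp add: distrib_left)
  also have "\<dots> \<le> E + 1" using An1 e by simp
  finally show "e * hsn l (n+1) z \<le> E + 1" .
qed

text \<open>The dissipation offers four times the truncated norm at level n+2, and each of the four
  error terms \<open>low\<close>, \<open>high\<close>, \<open>src\<close>, \<open>lin\<close> spends
  exactly one of them.\<close>

lemma energy_rate_le:
  fixes z z' \<psi> \<psi>' :: "real \<Rightarrow> real"
  assumes l: "l > 0" and e: "e > 0" "e \<le> 1" and F: "finite F"
    and z: "Hs l (n+2) z"
    and tail: "(\<Sum>\<^sub>\<infinity>k\<in>UNIV - F. ((wt l k)^(n+2) * cmod (fcoef l z k))^2) \<le> 1"
    and \<psi>: "Hs l (n+3) \<psi>" "hsn l (n+3) \<psi> \<le> G" and \<psi>': "Hs l n \<psi>'" "hsn l n \<psi>' \<le> G"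
    and P: "P = 2^(n+3) * (wt_sum l + G + 1)"
    and E: "E = (\<Sum>k\<in>F. (wt l k)^(2 * n) * bsym l e k * (cmod (fcoef l z k))^2)"
    and small: "e * (E + 1) \<le> 1" "78 * P * e \<le> 1"
    and eq: "\<And>k. complex_of_real (bsym l e k) * fcoef l z' k + complex_of_real (hsym l e k) * fcoef l \<psi>' k
      = complex_of_real (ssym l k) * fcoef l z k
        + complex_of_real (msym l e k) * dsym l k * fcoef l (\<lambda>x. (\<psi> x)^2) k
        + complex_of_real (e * fsym l e k) * dsym l k * fcoef l (\<lambda>x. (z x)^2) k
        + complex_of_real (2 * fsym l e k) * dsym l k * fcoef l (\<lambda>x. \<psi> x * z x) k"
  shows "(\<Sum>k\<in>F. 2 * ((wt l k)^(2 * n) * bsym l e k * (fcoef l z k \<bullet> fcoef l z' k)))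
    \<le> (12 + P^2) * E + (144 * G + 1521 * P^2 * G + P^2 + 1)"
proof -
  have G0: "G \<ge> 0" using \<psi>(2) hsn_nonneg[of l "n+3" \<psi>] by linarith
  have P1: "P \<ge> 1"
    unfolding P using wt_sum_nonneg[of l] G0
    by (intro mult_ge1_I) auto
  \<comment> \<open>The two quadratic terms combine into the single product \<open>(e z + 2 \<psi>) z\<close>, so that one
    \<open>\<ell>\<^sup>1\<close> majorant \<open>p\<close> serves for both of them. It is bounded independently of \<open>e\<close>: the energy
    controls \<open>e * hsn l (n+1) z\<close>, hence \<open>e * \<bar>z\<bar>\<close> in \<open>\<ell>\<^sup>1\<close>, as long as \<open>e * (E + 1) \<le> 1\<close>.\<close>
  define x where "x r k = (wt l k)^r * cmod (fcoef l z k)" for r k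
  define A where "A r = (\<Sum>k\<in>F. (x r k)^2)" for r
  define q where "q k = complex_of_real e * fcoef l (\<lambda>x. (z x)^2) k + 2 * fcoef l (\<lambda>x. \<psi> x * z x) k" for k
  define R where "R k = fcoef l (\<lambda>x. (\<psi> x)^2) k" for k
  have x0: "x r k \<ge> 0" for r k by (simp add: x_def)
  have A0: "A r \<ge> 0" for r unfolding A_def by (rule sum_nonneg) simp
  have A_mono: "A r \<le> A s" if "r \<le> s" for r s
    unfolding A_def x_def by (intro sum_mono wt_term_mono that)
  have hA: "hsn l r z \<le> A r + 1" if "r \<le> n + 2" for r
    using hsn_le_finite_part[OF F z that tail] by (simp add: A_def x_def)
  note eb = energy_bounds[OF e F z tail E]
  have AE: "A n \<le> E" using eb(1) by (simp add: A_def x_def)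
  have z1: "Hs l (Suc 0) z" and zn: "Hs l n z"
    by (rule Hs_mono[OF _ z], simp)+
  have \<psi>2: "Hs l (Suc (n+2)) \<psi>" "Hs l (n+2) \<psi>"
    using \<psi>(1) Hs_mono[OF _ \<psi>(1), of "n+2"] by (simp_all add: numeral_3_eq_3)
  have \<psi>sum: "(\<Sum>\<^sub>\<infinity>k. c * ((wt l k)^(n+2) * cmod (fcoef l \<psi> k))) \<le> (wt_sum l + c^2 * G) / 2" if "c \<ge> 0" for c
    using coef_weighted_l1(2)[OF l \<psi>2(1) that] mult_left_mono[OF \<psi>(2), of "c^2"]
    by (simp add: numeral_3_eq_3)

  define p where "p k = 2^(Suc (n+2)) * (e * cmod (fcoef l z k) + (wt l k)^(n+2) * cmod (fcoef l \<psi> k))" for k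
  have p0: "p k \<ge> 0" for k using e by (simp add: p_def)
  have s1: "(\<lambda>k. e * cmod (fcoef l z k)) summable_on UNIV"
    using coef_weighted_l1(1)[OF l z1, of e] e by simp
  have s2: "(\<lambda>k. (wt l k)^(n+2) * cmod (fcoef l \<psi> k)) summable_on UNIV"
    using coef_weighted_l1(1)[OF l \<psi>2(1), of 1] by simp
  have ps: "p summable_on UNIV"
    unfolding p_def by (intro summable_on_cmult_right summable_on_add s1 s2)
  have pP: "infsum p UNIV \<le> P"
  proof -
    have "e^2 * hsn l (Suc 0) z \<le> e^2 * hsn l (n+1) z"
      by (intro mult_left_mono hsn_mono Hs_mono[OF _ z]) auto
    also have "\<dots> = e * (e * hsn l (n+1) z)" by (simp add: power2_eq_square)
    also have "\<dots> \<le> e * (E + 1)" using eb(3) e by (intro mult_left_mono) auto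
    finally have ee: "e^2 * hsn l (Suc 0) z \<le> 1" using small(1) by simp
    have "infsum p UNIV = 2^(Suc (n+2)) * ((\<Sum>\<^sub>\<infinity>k. e * cmod (fcoef l z k))
        + (\<Sum>\<^sub>\<infinity>k. (wt l k)^(n+2) * cmod (fcoef l \<psi> k)))"
      unfolding p_def by (simp only: infsum_cmult_right' infsum_add[OF s1 s2])
    also have "\<dots> \<le> 2^(Suc (n+2)) * ((wt_sum l + 1) / 2 + (wt_sum l + G) / 2)"
      using coef_weighted_l1(2)[OF l z1, of e] \<psi>sum[of 1] ee e
      by (intro mult_left_mono add_mono) auto
    also have "(2::real)^(Suc (n+2)) = 2^(n+3)" by (simp add: power_add)
    also have "2^(n+3) * ((wt_sum l + 1) / 2 + (wt_sum l + G) / 2) \<le> P"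
      unfolding P using G0 by (intro mult_left_mono) (auto simp: field_simps)
    finally show ?thesis .
  qed
  have qx: "(wt l k)^r * cmod (q k) \<le> (\<Sum>\<^sub>\<infinity>j. p (k - j) * x r j)" if "r \<le> n+2" for r k
    unfolding q_def p_def x_def
    by (rule quadratic_coef_le[OF l e(1) that z1 Hs_mono[OF that z] \<psi>2(1)])
  have xs: "(\<lambda>k. (x r k)^2) summable_on UNIV" if "r \<le> n+2" for r
    unfolding x_def by (rule Hs_summable[OF Hs_mono[OF that z]])
  have xh: "(\<Sum>\<^sub>\<infinity>k. (x r k)^2) = hsn l r z" for r
    by (simp add: x_def hsn_eq)

  have low: "(\<Sum>k\<in>F. 2 * (x (n+1) k * ((wt l k)^n * cmod (q k)))) \<le> P^2 * (E + 1) + A (n+2)"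
  proof -
    have "(\<Sum>k\<in>F. x (n+1) k * ((wt l k)^n * cmod (q k)))
        \<le> (\<Sum>k\<in>F. x (n+1) k * (\<Sum>\<^sub>\<infinity>j. p (k - j) * x n j))"
      by (intro sum_mono mult_left_mono qx x0) simp
    \<comment> \<open>This choice has \<open>4 * \<alpha> * \<beta> = 1\<close> and leaves 1/2 on
      the part at level n+1, one unit after doubling. The price \<open>P^2\<close> falls on level n
      and becomes part of the growth rate.\<close>
    also have "\<dots> \<le> P * ((P/2) * (\<Sum>\<^sub>\<infinity>k. (x n k)^2) + (1 / (2*P)) * (\<Sum>k\<in>F. (x (n+1) k)^2))"
      by (rule schur_bound[OF F ps p0 pP xs]) (use x0 P1 in auto)
    also have "\<dots> = P^2 / 2 * hsn l n z + A (n+1) / 2"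
      unfolding xh A_def[symmetric] using P1 by (simp add: field_simps power2_eq_square)
    finally have "(\<Sum>k\<in>F. x (n+1) k * ((wt l k)^n * cmod (q k))) \<le> P^2 / 2 * hsn l n z + A (n+1) / 2" .
    moreover have "P^2 * hsn l n z \<le> P^2 * (E + 1)"
      using eb(2) by (intro mult_left_mono) auto
    moreover have "A (n+1) \<le> A (n+2)" by (rule A_mono) simp
    ultimately show ?thesis by (simp add: sum_distrib_left[symmetric])
  qed
  have high: "(\<Sum>k\<in>F. 78 * e * (x (n+2) k * ((wt l k)^(n+2) * cmod (q k)))) \<le> A (n+2) + 1"
  proof -
    have "(\<Sum>k\<in>F. x (n+2) k * ((wt l k)^(n+2) * cmod (q k)))
        \<le> (\<Sum>k\<in>F. x (n+2) k * (\<Sum>\<^sub>\<infinity>j. p (k - j) * x (n+2) j))"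
      by (intro sum_mono mult_left_mono qx x0) simp
    \<comment> \<open>Both factors sit at the level of the dissipation, so no choice of parameters
      helps; only the smallness of \<open>e\<close> does.\<close>
    also have "\<dots> \<le> P * ((1/2) * (\<Sum>\<^sub>\<infinity>k. (x (n+2) k)^2) + (1/2) * (\<Sum>k\<in>F. (x (n+2) k)^2))"
      by (rule schur_bound[OF F ps p0 pP xs]) (use x0 in auto)
    also have "\<dots> \<le> P * (A (n+2) + 1)"
      unfolding xh A_def[symmetric] using hA[of "n+2"] P1 by (intro mult_left_mono) auto
    finally have "78 * e * (\<Sum>k\<in>F. x (n+2) k * ((wt l k)^(n+2) * cmod (q k))) \<le> 78 * e * (P * (A (n+2) + 1))"
      using e by (intro mult_left_mono) auto
    also have "\<dots> = (78 * P * e) * (A (n+2) + 1)" by simp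
    also have "\<dots> \<le> 1 * (A (n+2) + 1)" using small(2) A0[of "n+2"] by (intro mult_right_mono) auto
    finally show ?thesis by (simp add: sum_distrib_left)
  qed
  have src: "(\<Sum>k\<in>F. 78 * (x (n+2) k * ((wt l k)^(n+2) * cmod (R k)))) \<le> 1521 * P^2 * G + A (n+2)"
  proof -
    let ?y = "\<lambda>k. (wt l k)^(n+2) * cmod (fcoef l \<psi> k)"
    have "(wt l k)^(n+2) * cmod (R k) \<le> (\<Sum>\<^sub>\<infinity>j. (2^(n+2) * ?y (k - j)) * ?y j)" for k
      using weighted_product_le(2)[OF l \<psi>2, of k] unfolding R_def power2_eq_square .
    then have "(\<Sum>k\<in>F. x (n+2) k * ((wt l k)^(n+2) * cmod (R k)))
        \<le> (\<Sum>k\<in>F. x (n+2) k * (\<Sum>\<^sub>\<infinity>j. (2^(n+2) * ?y (k - j)) * ?y j))"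
      by (intro sum_mono mult_left_mono x0)
    \<comment> \<open>The prefactor 78 of the source term must leave one unit of dissipation, hence
      \<open>1 / (78 * P)\<close>; then 1521 is 78 * 78 / 4.\<close>
    also have "\<dots> \<le> P * ((78 * P / 4) * (\<Sum>\<^sub>\<infinity>k. (?y k)^2) + (1 / (78 * P)) * (\<Sum>k\<in>F. (x (n+2) k)^2))"
    proof (rule schur_bound[OF F, where p = "\<lambda>k. 2^(n+2) * ?y k"])
      show "(\<lambda>k. 2^(n+2) * ?y k) summable_on UNIV" by (intro summable_on_cmult_right s2)
      have "(\<Sum>\<^sub>\<infinity>k. 2^(n+2) * ?y k) = 2^(n+2) * infsum ?y UNIV" by (rule infsum_cmult_right')
      also have "\<dots> \<le> 2^(n+2) * ((wt_sum l + G) / 2)"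
        using \<psi>sum[of 1] by (intro mult_left_mono) auto
      also have "\<dots> \<le> 2^(n+3) * (wt_sum l + G + 1)"
        using wt_sum_nonneg[of l] G0 by (intro mult_mono power_increasing) auto
      finally show "(\<Sum>\<^sub>\<infinity>k. 2^(n+2) * ?y k) \<le> P" unfolding P .
      show "(\<lambda>k. (?y k)^2) summable_on UNIV" by (rule Hs_summable[OF \<psi>2(2)])
    qed (use x0 P1 in auto)
    also have "(\<Sum>\<^sub>\<infinity>k. (?y k)^2) = hsn l (n+2) \<psi>" by (simp add: hsn_eq)
    also have "P * ((78 * P / 4) * hsn l (n+2) \<psi> + (1 / (78 * P)) * (\<Sum>k\<in>F. (x (n+2) k)^2))
        = (78 / 4 * P^2) * hsn l (n+2) \<psi> + A (n+2) / 78"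
      unfolding A_def[symmetric] using P1 by (simp add: field_simps power2_eq_square)
    finally have *: "(\<Sum>k\<in>F. x (n+2) k * ((wt l k)^(n+2) * cmod (R k)))
        \<le> (78 / 4 * P^2) * hsn l (n+2) \<psi> + A (n+2) / 78" .
    have "hsn l (n+2) \<psi> \<le> G" using hsn_mono[of "n+2" "n+3" l \<psi>] \<psi> by simp
    then have "P^2 * hsn l (n+2) \<psi> \<le> P^2 * G" by (intro mult_left_mono) auto
    then show ?thesis using * by (simp add: sum_distrib_left[symmetric])
  qed
  have lin: "(\<Sum>k\<in>F. 24 * (x (n+2) k * ((wt l k)^n * cmod (fcoef l \<psi>' k)))) \<le> A (n+2) + 144 * G"
  proof -
    let ?y = "\<lambda>k. (wt l k)^n * cmod (fcoef l \<psi>' k)"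
    have "24 * (x (n+2) k * ?y k) \<le> (x (n+2) k)^2 + 144 * (?y k)^2" for k
      using mult_le_half_squares[of "x (n+2) k" "12 * ?y k"] by (simp add: power_mult_distrib)
    then have "(\<Sum>k\<in>F. 24 * (x (n+2) k * ?y k)) \<le> (\<Sum>k\<in>F. (x (n+2) k)^2 + 144 * (?y k)^2)"
      by (rule sum_mono)
    also have "\<dots> = A (n+2) + 144 * (\<Sum>k\<in>F. (?y k)^2)"
      by (simp add: A_def sum.distrib sum_distrib_left)
    also have "(\<Sum>k\<in>F. (?y k)^2) \<le> hsn l n \<psi>'"
      unfolding hsn_eq by (intro finite_sum_le_infsum Hs_summable \<psi>' F) auto
    finally show ?thesis using \<psi>'(2) by simp
  qed

  have "(\<Sum>k\<in>F. 2 * ((wt l k)^(2 * n) * bsym l e k * (fcoef l z k \<bullet> fcoef l z' k)))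
      \<le> (\<Sum>k\<in>F. 12 * (x n k)^2 - 4 * (x (n+2) k)^2
        + 24 * (x (n+2) k * ((wt l k)^n * cmod (fcoef l \<psi>' k)))
        + 78 * (x (n+2) k * ((wt l k)^(n+2) * cmod (R k)))
        + 2 * (x (n+1) k * ((wt l k)^n * cmod (q k)))
        + 78 * e * (x (n+2) k * ((wt l k)^(n+2) * cmod (q k))))"
  proof (rule sum_mono)
    fix k
    show "2 * ((wt l k)^(2 * n) * bsym l e k * (fcoef l z k \<bullet> fcoef l z' k))
      \<le> 12 * (x n k)^2 - 4 * (x (n+2) k)^2
        + 24 * (x (n+2) k * ((wt l k)^n * cmod (fcoef l \<psi>' k)))
        + 78 * (x (n+2) k * ((wt l k)^(n+2) * cmod (R k)))
        + 2 * (x (n+1) k * ((wt l k)^n * cmod (q k)))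
        + 78 * e * (x (n+2) k * ((wt l k)^(n+2) * cmod (q k)))"
      unfolding x_def
    proof (rule mode_energy_rate_le[OF e])
      show "complex_of_real (bsym l e k) * fcoef l z' k + complex_of_real (hsym l e k) * fcoef l \<psi>' k
        = complex_of_real (ssym l k) * fcoef l z k + complex_of_real (msym l e k) * dsym l k * R k
          + complex_of_real (fsym l e k) * dsym l k * q k"
        unfolding eq R_def q_def by (simp add: algebra_simps)
    qed
  qed
  also have "\<dots> = 12 * A n - 4 * A (n+2)
      + (\<Sum>k\<in>F. 24 * (x (n+2) k * ((wt l k)^n * cmod (fcoef l \<psi>' k))))
      + (\<Sum>k\<in>F. 78 * (x (n+2) k * ((wt l k)^(n+2) * cmod (R k))))
      + (\<Sum>k\<in>F. 2 * (x (n+1) k * ((wt l k)^n * cmod (q k))))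
      + (\<Sum>k\<in>F. 78 * e * (x (n+2) k * ((wt l k)^(n+2) * cmod (q k))))"
    unfolding A_def by (simp only: sum.distrib sum_subtractf sum_distrib_left)
  also have "\<dots> \<le> 12 * E + 144 * G + 1521 * P^2 * G + P^2 * (E + 1) + 1"
    using low high src lin AE by linarith
  also have "\<dots> = (12 + P^2) * E + (144 * G + 1521 * P^2 * G + P^2 + 1)" by (simp add: algebra_simps)
  finally show ?thesis .
qed

theorem theorem5p3:
  fixes l0 T :: real and n :: nat
    and Phi Phi' Psi Psi' :: "real \<Rightarrow> real \<Rightarrow> real"
  assumes l0: "l0 > 0" and T: "T > 0"
    and KS: "KS_sol l0 T Phi Phi' Psi"
    and Psi_reg: "cont_Hs l0 (n+4) 0 T Psi" "deriv_L2 l0 0 T Psi Psi'"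
                 "cont_Hs l0 (n+2) 0 T Psi'"
  shows "\<exists>eps1 K. 0 < eps1 \<and> eps1 < 1 \<and> K > 0 \<and>
    (\<forall>e T1 z z'. 0 < e \<longrightarrow> e \<le> eps1 \<longrightarrow> 0 < T1 \<longrightarrow> T1 \<le> T \<longrightarrow>
       Yn l0 n T1 z z' \<longrightarrow>
       (\<forall>t\<in>{0..T1}. integral {-l0/2..l0/2} (z t) = 0) \<longrightarrow>
       (\<forall>k. fcoef l0 (z 0) k = 0) \<longrightarrow>
       eq_star l0 e T1 z z' Psi Psi' \<longrightarrow>
       (\<forall>t1\<in>{0..T1}. \<forall>t2\<in>{0..T1}. \<forall>g1 g2.
          wder l0 n (z t1) g1 \<longrightarrow> wder l0 (n+1) (z t2) g2 \<longrightarrow>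
          integral {-l0/2..l0/2} (\<lambda>x. (g1 x)^2)
            + e * integral {-l0/2..l0/2} (\<lambda>x. (g2 x)^2) \<le> K))"
proof -
  \<comment> \<open>The fourth-order terms put n+2 weights on \<open>Psi\<close>, and one more
    derivative makes the weighted coefficients summable.\<close>
  have Psi3: "cont_Hs l0 (n+3) 0 T Psi" by (rule cont_Hs_mono[OF _ Psi_reg(1)]) simp
  have Psi'0: "cont_Hs l0 n 0 T Psi'" by (rule cont_Hs_mono[OF _ Psi_reg(3)]) simp
  obtain G1 where G1: "\<And>t. t \<in> {0..T} \<Longrightarrow> hsn l0 (n+3) (Psi t) \<le> G1"
    using cont_Hs_bounded[OF Psi3] by blast
  obtain G2 where G2: "\<And>t. t \<in> {0..T} \<Longrightarrow> hsn l0 n (Psi' t) \<le> G2"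
    using cont_Hs_bounded[OF Psi'0] by blast
  define G where "G = max 0 (max G1 G2)"
  define P where "P = 2^(n+3) * (wt_sum l0 + G + 1)"
  have G0: "G \<ge> 0" by (simp add: G_def)
  have P0: "P > 0" unfolding P_def using wt_sum_nonneg[of l0] G0 by simp
  define c where "c = 12 + P^2"
  define c' where "c' = 144 * G + 1521 * P^2 * G + P^2 + 1"
  have c: "c > 0" "c' \<ge> 0" using G0 by (auto simp: c_def c'_def add_pos_nonneg)
  \<comment> \<open>One more than the Gronwall bound, which gives the strict gap the continuation
    argument needs.\<close>
  define M where "M = c' / c * (exp (c * T) - 1) + 1"
  have M: "c' / c * (exp (c * T) - 1) < M" by (simp add: M_def)
  have M0: "M > 0" unfolding M_def using c T by (intro add_nonneg_pos mult_nonneg_nonneg) auto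
  \<comment> \<open>The three entries keep the threshold below 1, absorb the fourth-order quadratic
    part, and ensure \<open>e * (E + 1) \<le> 1\<close> as long as \<open>E \<le> M\<close>.\<close>
  define eps1 where "eps1 = min (1/2) (min (1 / (78 * P)) (1 / (M + 1)))"
  have eps1: "0 < eps1" "eps1 < 1" using P0 M0 by (auto simp: eps1_def)
  \<comment> \<open>The times \<open>t1\<close> and \<open>t2\<close> are independent, so that the
    bound covers the sum of the two suprema. Each integral contributes \<open>l0 * (M + 1)\<close>:
    the period comes from Parseval, the 1 from the modes outside the truncation.\<close>
  have bound: "integral (cell l0) (\<lambda>x. (g1 x)^2) + e * integral (cell l0) (\<lambda>x. (g2 x)^2) \<le> 2 * l0 * (M + 1)"
    if e: "0 < e" "e \<le> eps1" and T1: "0 < T1" "T1 \<le> T" and Y: "Yn l0 n T1 z z'"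
      and z0: "\<forall>k. fcoef l0 (z 0) k = 0" and eq: "eq_star l0 e T1 z z' Psi Psi'"
      and t12: "t1 \<in> {0..T1}" "t2 \<in> {0..T1}"
      and g: "wder l0 n (z t1) g1" "wder l0 (n+1) (z t2) g2"
    for e T1 z z' t1 t2 g1 g2
  proof -
    have e1: "e \<le> 1" using e eps1 by simp
    have "e \<le> 1 / (78 * P)" "e \<le> 1 / (M + 1)" using e by (auto simp: eps1_def)
    then have eP: "78 * P * e \<le> 1" and eM: "e * (M + 1) \<le> 1"
      using P0 M0 by (auto simp: field_simps)
    have zc: "cont_Hs l0 (n+2) 0 T1 z"
    proof (rule cont_Hs_mono)
      \<comment> \<open>For \<open>n \<le> 2\<close> the value 4 suffices, for larger
        \<open>n\<close> the value \<open>2 * n\<close>.\<close>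
      show "n + 2 \<le> max 4 (2 * n)" by auto
      show "cont_Hs l0 (max 4 (2 * n)) 0 T1 z" using Y by (simp add: Yn_def)
    qed
    have zd: "deriv_L2 l0 0 T1 z z'" using Y by (simp add: Yn_def)
    have zH: "Hs l0 (n+2) (z t)" if "t \<in> {0..T1}" for t by (rule cont_Hs_Hs[OF zc that])
    \<comment> \<open>The set depends on \<open>z\<close>, but \<open>P\<close>, \<open>M\<close>
      and \<open>eps1\<close> are already fixed, so the estimate does not feel its size.\<close>
    obtain F where F: "finite F"
      "\<And>t. t \<in> {0..T1} \<Longrightarrow> (\<Sum>\<^sub>\<infinity>k\<in>UNIV - F. ((wt l0 k)^(n+2) * cmod (fcoef l0 (z t) k))^2) \<le> 1"
      using cont_Hs_uniform_tail[OF zc] by blast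
    define E where "E t = (\<Sum>k\<in>F. (wt l0 k)^(2 * n) * bsym l0 e k * (cmod (fcoef l0 (z t) k))^2)" for t
    define E' where "E' t = (\<Sum>k\<in>F. 2 * ((wt l0 k)^(2 * n) * bsym l0 e k * (fcoef l0 (z t) k \<bullet> fcoef l0 (z' t) k)))" for t
    have dE: "(E has_real_derivative E' t) (at t within {0..T1})" if t: "t \<in> {0..T1}" for t
    proof -
      have "((\<lambda>s. (cmod (fcoef l0 (z s) k))^2) has_real_derivative 2 * (fcoef l0 (z t) k \<bullet> fcoef l0 (z' t) k))
          (at t within {0..T1})" for k
        using fcoef_has_vector_derivative[OF zd t, of k]
        unfolding power2_norm_eq_inner has_vector_derivative_def has_field_derivative_def
        by (auto intro!: derivative_eq_intros simp: inner_commute algebra_simps)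
      then have "(E has_real_derivative (\<Sum>k\<in>F. (wt l0 k)^(2 * n) * bsym l0 e k
          * (2 * (fcoef l0 (z t) k \<bullet> fcoef l0 (z' t) k)))) (at t within {0..T1})"
        unfolding E_def by (intro DERIV_sum DERIV_cmult)
      then show ?thesis unfolding E'_def by (simp only: mult_ac)
    qed
    have rate: "E' t \<le> c * E t + c'" if t: "t \<in> {0..T1}" and Et: "E t \<le> M" for t
    proof -
      have tT: "t \<in> {0..T}" using t T1 by auto
      show ?thesis unfolding E'_def c_def c'_def
      proof (rule energy_rate_le[OF l0 e(1) e1 F(1) zH[OF t] F(2)[OF t] cont_Hs_Hs[OF Psi3 tT] _
            cont_Hs_Hs[OF Psi'0 tT] _ P_def E_def _ eP])
        show "hsn l0 (n+3) (Psi t) \<le> G" "hsn l0 n (Psi' t) \<le> G"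
          using G1[OF tT] G2[OF tT] by (auto simp: G_def)
        show "e * (E t + 1) \<le> 1"
          using mult_left_mono[of "E t + 1" "M + 1" e] Et e(1) eM by linarith
      qed (use eq t in \<open>simp add: eq_star_def\<close>)
    qed
    have E0: "E 0 = 0" using z0 by (simp add: E_def)
    have EM: "E t \<le> M" if "t \<in> {0..T1}" for t
      by (rule gronwall_bootstrap[OF dE E0 c T1(2) rate M that])
    note eb = energy_bounds[OF e(1) e1 F(1) zH F(2) E_def]
    have "integral (cell l0) (\<lambda>x. (g1 x)^2) \<le> l0 * hsn l0 n (z t1)"
      by (rule integral_wder_le[OF l0 Hs_mono[OF _ zH[OF t12(1)]] g(1)]) simp
    also have "\<dots> \<le> l0 * (M + 1)"
      using eb(2)[OF t12(1) t12(1)] EM[OF t12(1)] l0 by (intro mult_left_mono) auto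
    finally have 1: "integral (cell l0) (\<lambda>x. (g1 x)^2) \<le> l0 * (M + 1)" .
    have "e * integral (cell l0) (\<lambda>x. (g2 x)^2) \<le> e * (l0 * hsn l0 (n+1) (z t2))"
      by (intro mult_left_mono integral_wder_le[OF l0 Hs_mono[OF _ zH[OF t12(2)]] g(2)]) (use e in auto)
    also have "\<dots> = l0 * (e * hsn l0 (n+1) (z t2))" by simp
    also have "\<dots> \<le> l0 * (M + 1)"
      using eb(3)[OF t12(2) t12(2)] EM[OF t12(2)] l0 by (intro mult_left_mono) auto
    finally show ?thesis using 1 by simp
  qed
  show ?thesis
    by (rule exI[of _ eps1], rule exI[of _ "2 * l0 * (M + 1)"])
      (use eps1 l0 M0 bound in \<open>auto simp del: minus_divide_left\<close>)
qed

end
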